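(* Let $m,n\ge 0$ be integers with $n\mid m/\gcd(2,m)$, and let $(A,B;D)$ be an amalgam of groups in the variety $(m,n)$. The amalgam is weakly embeddable in $(m,n)$ if and only if the following two conditions are satisfied: (1) $A^nA'\cap D\subseteq Z(B)$ and $B^nB'\cap D\subseteq Z(A)$. (2) For every integer $k>0$, all integers $q_i>0$ with $q_i\mid n$, all $a_i\in A$, $a_i'\in A^nA'$ with $a_i^{q_i}a_i'\in D$, all $b_i\in B$, $b_i'\in B^nB'$ with $b_i^{q_i}b_i'\in D$ ($i=1,\ldots,k$), and each $d\in D$, $$\prod_{i=1}^k[a_i,b_i^{q_i}b_i']=d\iff\prod_{i=1}^k[a_i^{q_i}a_i',b_i]=d,$$ where the first product is computed in $A$ and the second in $B$.
   Context: Commutators are $[x,y]=x^{-1}y^{-1}xy$ and $[x,y,z]=[[x,y],z]$; $G'=[G,G]$; $Z(G)$ is the center. For $k>0$, $G^k$ is the subgroup generated by all $k$-th powers of elements of $G$, and $G^0=\{e\}$. Every integer divides $0$, and $0$ divides only $0$. For nonnegative integers $m,n$ with $n\mid m/\gcd(2,m)$, $(m,n)$ denotes the variety (class) of all groups satisfying the identities $x^m=[x_1,x_2]^n=[x_1,x_2,x_3]=e$. In particular $(0,0)=\mathcal N_2$ is the variety of all nilpotent groups of class at most two. An amalgam $(A,B;D)$ of groups in a class $\mathcal C$ consists of groups $A,B,D\in\mathcal C$ together with injective homomorphisms $D\to A$ and $D\to B$; $D$ is identified with its images, so it is regarded as a subgroup of both $A$ and $B$. It is weakly embeddable in $\mathcal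 C$ if there are $M\in\mathcal C$ and injective homomorphisms $\lambda_A\colon A\to M$, $\lambda_B\colon B\to M$ which agree on $D$. *)

theory Defs
  imports "HOL-Algebra.Algebra"
begin

definition commutator :: "('a, 'r) monoid_scheme \<Rightarrow> 'a \<Rightarrow> 'a \<Rightarrow> 'a" where
  "commutator G x y = inv\<^bsub>G\<^esub> x \<otimes>\<^bsub>G\<^esub> inv\<^bsub>G\<^esub> y \<otimes>\<^bsub>G\<^esub> x \<otimes>\<^bsub>G\<^esub> y"

definition center :: "('a, 'r) monoid_scheme \<Rightarrow> 'a set" where
  "center G = {z \<in> carrier G. \<forall>x \<in> carrier G. z \<otimes>\<^bsub>G\<^esub> x = x \<otimes>\<^bsub>G\<^esub> z}"

definition power_subgroup :: "('a, 'r) monoid_scheme \<Rightarrow> nat \<Rightarrow> 'a set" where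
  "power_subgroup G k =
     (if k = 0 then {\<one>\<^bsub>G\<^esub>} else generate G {x [^]\<^bsub>G\<^esub> k | x. x \<in> carrier G})"

abbreviation commutator_subgroup :: "('a, 'r) monoid_scheme \<Rightarrow> 'a set" where
  "commutator_subgroup G \<equiv> derived G (carrier G)"

text \<open>The library builds \<^const>\<open>derived\<close> from the commutators \<open>x y x\<inverse> y\<inverse>\<close>. The convention
  \<open>x\<inverse> y\<inverse> x y\<close> used here gives the same subgroup.\<close>

lemma (in group) commutator_subgroup_eq:
  "commutator_subgroup G =
     generate G {commutator G x y | x y. x \<in> carrier G \<and> y \<in> carrier G}"
proof -
  have "derived_set G (carrier G) = {commutator G x y | x y. x \<in> carrier G \<and> y \<in> carrier G}"
    (is "?L = ?R")
  proof
    show "?L \<subseteq> ?R"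
    proof
      fix z assume "z \<in> ?L"
      then obtain x y where xy: "x \<in> carrier G" "y \<in> carrier G" "z = x \<otimes> y \<otimes> inv x \<otimes> inv y"
        by blast
      then have "z = commutator G (inv x) (inv y)"
        by (simp add: commutator_def)
      with xy show "z \<in> ?R" by blast
    qed
    show "?R \<subseteq> ?L"
    proof
      fix z assume "z \<in> ?R"
      then obtain x y where xy: "x \<in> carrier G" "y \<in> carrier G" "z = commutator G x y"
        by blast
      then have "z = inv x \<otimes> inv y \<otimes> inv (inv x) \<otimes> inv (inv y)"
        by (simp add: commutator_def)
      moreover have "inv x \<in> carrier G" "inv y \<in> carrier G"
        using xy by simp_all
      ultimately show "z \<in> ?L" by blast
    qed
  qed
  then show ?thesis by (simp add: derived_def)
qed

text \<open>The ordered product \<open>f 1 \<otimes> f 2 \<otimes> \<dots> \<otimes> f k\<close>, for a group that need not be commutative.\<close>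

definition ordered_prod :: "('a, 'r) monoid_scheme \<Rightarrow> (nat \<Rightarrow> 'a) \<Rightarrow> nat \<Rightarrow> 'a" where
  "ordered_prod G f k = foldr (\<otimes>\<^bsub>G\<^esub>) (map f [1..<Suc k]) \<one>\<^bsub>G\<^esub>"

definition in_variety :: "nat \<Rightarrow> nat \<Rightarrow> ('a, 'r) monoid_scheme \<Rightarrow> bool" where
  "in_variety m n G \<longleftrightarrow>
     group G \<and>
     (\<forall>x \<in> carrier G. x [^]\<^bsub>G\<^esub> m = \<one>\<^bsub>G\<^esub>) \<and>
     (\<forall>x \<in> carrier G. \<forall>y \<in> carrier G. commutator G x y [^]\<^bsub>G\<^esub> n = \<one>\<^bsub>G\<^esub>) \<and>
     (\<forall>x \<in> carrier G. \<forall>y \<in> carrier G. \<forall>z \<in> carrier G.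
        commutator G (commutator G x y) z = \<one>\<^bsub>G\<^esub>)"

definition amalgam ::
  "nat \<Rightarrow> nat \<Rightarrow> ('a, 'r) monoid_scheme \<Rightarrow> ('b, 's) monoid_scheme \<Rightarrow> ('d, 't) monoid_scheme
     \<Rightarrow> ('d \<Rightarrow> 'a) \<Rightarrow> ('d \<Rightarrow> 'b) \<Rightarrow> bool" where
  "amalgam m n A B D \<alpha> \<beta> \<longleftrightarrow>
     in_variety m n A \<and> in_variety m n B \<and> in_variety m n D \<and>
     \<alpha> \<in> hom D A \<and> inj_on \<alpha> (carrier D) \<and>
     \<beta> \<in> hom D B \<and> inj_on \<beta> (carrier D)"

definition weak_embedding ::
  "nat \<Rightarrow> nat \<Rightarrow> ('a, 'r) monoid_scheme \<Rightarrow> ('b, 's) monoid_scheme \<Rightarrow> ('d, 't) monoid_scheme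
     \<Rightarrow> ('d \<Rightarrow> 'a) \<Rightarrow> ('d \<Rightarrow> 'b)
     \<Rightarrow> ('m, 'u) monoid_scheme \<Rightarrow> ('a \<Rightarrow> 'm) \<Rightarrow> ('b \<Rightarrow> 'm) \<Rightarrow> bool" where
  "weak_embedding m n A B D \<alpha> \<beta> M \<phi> \<psi> \<longleftrightarrow>
     in_variety m n M \<and>
     \<phi> \<in> hom A M \<and> inj_on \<phi> (carrier A) \<and>
     \<psi> \<in> hom B M \<and> inj_on \<psi> (carrier B) \<and>
     (\<forall>d \<in> carrier D. \<phi> (\<alpha> d) = \<psi> (\<beta> d))"

text \<open>HOL cannot quantify existentially over the type of \<open>M\<close>. Words over \<open>A + B\<close> are a large
  enough supply of elements, because the images of \<open>A\<close> and \<open>B\<close> generate a subgroup of \<open>M\<close> each of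
  whose elements is the value of such a word. Lemma \<open>weakly_embeddableI\<close> below proves that a
  weak embedding into a group of the variety over any type whatsoever yields one over this
  type, so no generality is lost.\<close>

definition weakly_embeddable ::
  "nat \<Rightarrow> nat \<Rightarrow> ('a, 'r) monoid_scheme \<Rightarrow> ('b, 's) monoid_scheme \<Rightarrow> ('d, 't) monoid_scheme
     \<Rightarrow> ('d \<Rightarrow> 'a) \<Rightarrow> ('d \<Rightarrow> 'b) \<Rightarrow> bool" where
  "weakly_embeddable m n A B D \<alpha> \<beta> \<longleftrightarrow>
     (\<exists>(M :: ('a + 'b) list monoid) \<phi> \<psi>. weak_embedding m n A B D \<alpha> \<beta> M \<phi> \<psi>)"

lemma in_variety_inj_hom:
  assumes M: "in_variety m n M" and N: "group N"
    and h: "h \<in> hom N M" and inj: "inj_on h (carrier N)"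
  shows "in_variety m n N"
proof -
  have gM: "group M" using M by (simp add: in_variety_def)
  interpret h: group_hom N M h
    using N gM h by (simp add: group_hom_def group_hom_axioms_def)
  have comm_closed: "commutator N x y \<in> carrier N"
    if "x \<in> carrier N" "y \<in> carrier N" for x y
    using that by (simp add: commutator_def)
  have h_comm: "h (commutator N x y) = commutator M (h x) (h y)"
    if "x \<in> carrier N" "y \<in> carrier N" for x y
    using that by (simp add: commutator_def)
  have eq1: "x = \<one>\<^bsub>N\<^esub>" if "x \<in> carrier N" "h x = \<one>\<^bsub>M\<^esub>" for x
    using inj_onD[OF inj, of x "\<one>\<^bsub>N\<^esub>"] that by simp
  show ?thesis
    unfolding in_variety_def
  proof (intro conjI ballI)
    show "group N" by (fact N)
  next
    fix x assume "x \<in> carrier N"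
    then show "x [^]\<^bsub>N\<^esub> m = \<one>\<^bsub>N\<^esub>"
      using M by (intro eq1) (simp_all add: h.hom_nat_pow in_variety_def)
  next
    fix x y assume "x \<in> carrier N" "y \<in> carrier N"
    then show "commutator N x y [^]\<^bsub>N\<^esub> n = \<one>\<^bsub>N\<^esub>"
      using M by (intro eq1) (simp_all add: h.hom_nat_pow comm_closed h_comm in_variety_def)
  next
    fix x y z assume "x \<in> carrier N" "y \<in> carrier N" "z \<in> carrier N"
    then show "commutator N (commutator N x y) z = \<one>\<^bsub>N\<^esub>"
      using M by (intro eq1) (simp_all add: comm_closed h_comm in_variety_def)
  qed
qed

lemma weakly_embeddableI:
  fixes M :: "('m, 'u) monoid_scheme"
    and A :: "('a, 'r) monoid_scheme" and B :: "('b, 's) monoid_scheme"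
  assumes A: "group A" and B: "group B" and emb: "weak_embedding m n A B D \<alpha> \<beta> M \<phi> \<psi>"
  shows "weakly_embeddable m n A B D \<alpha> \<beta>"
proof -
  have M: "in_variety m n M" and hA: "\<phi> \<in> hom A M" and iA: "inj_on \<phi> (carrier A)"
    and hB: "\<psi> \<in> hom B M" and iB: "inj_on \<psi> (carrier B)"
    and agree: "\<forall>d \<in> carrier D. \<phi> (\<alpha> d) = \<psi> (\<beta> d)"
    using emb by (auto simp: weak_embedding_def)
  interpret M: group M using M by (simp add: in_variety_def)
  interpret hA: group_hom A M \<phi>
    using A hA by (simp add: group_hom_def group_hom_axioms_def M.group_axioms)
  interpret hB: group_hom B M \<psi>
    using B hB by (simp add: group_hom_def group_hom_axioms_def M.group_axioms)
  define T where "T = \<phi> ` carrier A \<union> \<psi> ` carrier B"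
  define S where "S = generate M T"
  have T: "T \<subseteq> carrier M" by (auto simp: T_def)
  have subS: "subgroup S M" unfolding S_def by (rule M.generate_is_subgroup[OF T])
  have TS: "T \<subseteq> S" unfolding S_def by (auto intro: generate.incl)
  define L where "L = lists (Inl ` carrier A \<union> Inr ` carrier B :: ('a + 'b) set)"
  define ev where "ev w = foldr (\<otimes>\<^bsub>M\<^esub>) (map (case_sum \<phi> \<psi>) w) \<one>\<^bsub>M\<^esub>" for w :: "('a + 'b) list"
  have ev_Nil: "ev [] = \<one>\<^bsub>M\<^esub>" by (simp add: ev_def)
  have ev_Cons: "ev (c # w) = case_sum \<phi> \<psi> c \<otimes>\<^bsub>M\<^esub> ev w" for c w by (simp add: ev_def)
  have c_closed: "case_sum \<phi> \<psi> c \<in> carrier M" if "c \<in> Inl ` carrier A \<union> Inr ` carrier B" for c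
    using that by auto
  have ev_closed: "ev w \<in> carrier M" if "w \<in> L" for w
    using that unfolding L_def
    by (induction w rule: lists.induct) (simp_all add: ev_Nil ev_Cons c_closed del: Un_iff)
  have ev_append: "ev (v @ w) = ev v \<otimes>\<^bsub>M\<^esub> ev w" if "v \<in> L" "w \<in> L" for v w
    using that(1) unfolding L_def
  proof (induction v rule: lists.induct)
    case Nil
    then show ?case using ev_closed[OF that(2)] by (simp add: ev_Nil)
  next
    case (Cons c v)
    then have "ev v \<in> carrier M" using ev_closed by (simp add: L_def)
    then show ?case
      using Cons c_closed[OF Cons(1)] ev_closed[OF that(2)] by (simp add: ev_Cons M.m_assoc)
  qed
  have single: "\<exists>w \<in> L. ev w = t" if "t \<in> T" for t
  proof -
    have "T = case_sum \<phi> \<psi> ` (Inl ` carrier A \<union> Inr ` carrier B)"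
      by (simp add: T_def image_Un image_image)
    with that obtain c where c: "c \<in> Inl ` carrier A \<union> Inr ` carrier B" "t = case_sum \<phi> \<psi> c"
      by blast
    then have "[c] \<in> L" "ev [c] = t"
      using c(1) c_closed[OF c(1)] by (simp_all add: L_def ev_Cons ev_Nil c(2))
    then show ?thesis by blast
  qed
  have T_inv: "inv\<^bsub>M\<^esub> t \<in> T" if t: "t \<in> T" for t
  proof -
    consider x where "x \<in> carrier A" "t = \<phi> x" | y where "y \<in> carrier B" "t = \<psi> y"
      using t unfolding T_def by blast
    then show ?thesis
    proof cases
      case 1
      then have "inv\<^bsub>M\<^esub> t = \<phi> (inv\<^bsub>A\<^esub> x)" by simp
      with 1 show ?thesis by (simp add: T_def del: hA.hom_inv)
    next
      case 2
      then have "inv\<^bsub>M\<^esub> t = \<psi> (inv\<^bsub>B\<^esub> y)" by simp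
      with 2 show ?thesis by (simp add: T_def del: hB.hom_inv)
    qed
  qed
  have S_ev: "\<exists>w \<in> L. ev w = s" if "s \<in> S" for s
    using that unfolding S_def
  proof (induction s rule: generate.induct)
    case one
    have "[] \<in> L" by (simp add: L_def)
    then show ?case using ev_Nil by blast
  next
    case (incl h)
    then show ?case by (rule single)
  next
    case (inv h)
    then show ?case by (intro single T_inv)
  next
    case (eng h1 h2)
    then obtain v w where "v \<in> L" "ev v = h1" "w \<in> L" "ev w = h2" by blast
    then have "v @ w \<in> L" "ev (v @ w) = h1 \<otimes>\<^bsub>M\<^esub> h2"
      using ev_append by (auto simp: L_def)
    then show ?case by blast
  qed
  define SM where "SM = M\<lparr>carrier := S\<rparr>"
  have carSM: "carrier SM = S" and multSM: "(\<otimes>\<^bsub>SM\<^esub>) = (\<otimes>\<^bsub>M\<^esub>)"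
    by (simp_all add: SM_def)
  have gS: "group SM"
    unfolding SM_def using subgroup.subgroup_is_group[OF subS M.group_axioms] .
  define g where "g = inv_into UNIV ev"
  have ev_g: "ev (g s) = s" if "s \<in> S" for s
    unfolding g_def using S_ev[OF that] by (intro f_inv_into_f) auto
  have inj_g: "inj_on g (carrier SM)"
    unfolding carSM by (rule inj_on_inverseI[of _ ev]) (rule ev_g)
  define N where "N = image_group g SM"
  have gN: "group N"
    unfolding N_def by (rule group.inj_imp_image_group_is_group[OF gS inj_g])
  have g_iso: "g \<in> iso SM N"
    unfolding N_def by (rule inj_imp_image_group_iso[OF inj_g])
  then have g_hom: "g \<in> hom SM N" and carN: "carrier N = g ` S"
    by (auto simp: iso_def bij_betw_def carSM)
  have g_mult: "g (x \<otimes>\<^bsub>M\<^esub> y) = g x \<otimes>\<^bsub>N\<^esub> g y" if "x \<in> S" "y \<in> S" for x y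
    using hom_mult[OF g_hom, of x y] that by (simp add: carSM multSM)
  have S_mult: "x \<otimes>\<^bsub>M\<^esub> y \<in> S" if "x \<in> S" "y \<in> S" for x y
    using subgroup.m_closed[OF subS that] .
  have S_car: "S \<subseteq> carrier M" using subgroup.subset[OF subS] .
  have ev_hom: "ev \<in> hom N M"
  proof (rule homI)
    show "ev x \<in> carrier M" if "x \<in> carrier N" for x
      using that S_car by (auto simp: carN ev_g)
    show "ev (x \<otimes>\<^bsub>N\<^esub> y) = ev x \<otimes>\<^bsub>M\<^esub> ev y" if "x \<in> carrier N" "y \<in> carrier N" for x y
    proof -
      from that obtain s t where st: "s \<in> S" "x = g s" "t \<in> S" "y = g t" by (auto simp: carN)
      then have "ev (x \<otimes>\<^bsub>N\<^esub> y) = ev (g (s \<otimes>\<^bsub>M\<^esub> t))" by (simp add: g_mult)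
      then show ?thesis by (simp add: st ev_g S_mult)
    qed
  qed
  have ev_inj: "inj_on ev (carrier N)"
    by (auto simp: inj_on_def carN ev_g)
  have N: "in_variety m n N"
    by (rule in_variety_inj_hom[OF M gN ev_hom ev_inj])
  have AS: "\<phi> x \<in> S" if "x \<in> carrier A" for x using that TS by (auto simp: T_def)
  have BS: "\<psi> x \<in> S" if "x \<in> carrier B" for x using that TS by (auto simp: T_def)
  have "weak_embedding m n A B D \<alpha> \<beta> N (g \<circ> \<phi>) (g \<circ> \<psi>)"
    unfolding weak_embedding_def
  proof (intro conjI ballI)
    show "in_variety m n N" by (fact N)
    show "g \<circ> \<phi> \<in> hom A N"
      by (rule homI) (simp_all add: AS carN g_mult)
    show "g \<circ> \<psi> \<in> hom B N"
      by (rule homI) (simp_all add: BS carN g_mult)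
    show "inj_on (g \<circ> \<phi>) (carrier A)"
      using iA inj_g AS by (intro comp_inj_on) (auto simp: carSM intro: inj_on_subset)
    show "inj_on (g \<circ> \<psi>) (carrier B)"
      using iB inj_g BS by (intro comp_inj_on) (auto simp: carSM intro: inj_on_subset)
    show "(g \<circ> \<phi>) (\<alpha> d) = (g \<circ> \<psi>) (\<beta> d)" if "d \<in> carrier D" for d
      using agree that by simp
  qed
  then show ?thesis unfolding weakly_embeddable_def by blast
qed

end

theory Submission
  imports Defs
begin

text \<open>
  Write \<open>V(G) = G\<^sup>n G'\<close>, which is central in every group of the variety. In an overgroup \<open>M\<close> the
  commutators \<open>[a, b]\<close> with \<open>a \<in> A\<close>, \<open>b \<in> B\<close> define a bilinear map on \<open>A/V(A) \<times> B/V(B)\<close> that is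
  prescribed on \<open>A \<times> D\<close> (by commutators of \<open>A\<close>) and on \<open>D \<times> B\<close> (by commutators of \<open>B\<close>). Condition (1)
  makes these two partial maps well defined on the quotients, and both sides in condition (2) are
  evaluations of \<open>[a, b]\<^sup>q\<close>, so (1) and (2) are necessary.

  Conversely, (2) says that \<open>A\<close> and \<open>B\<close> survive when the two partial maps are given values in the
  pushout of \<open>A'\<close> and \<open>B'\<close> by the relations \<open>[a, b\<^sup>q b'] = [a\<^sup>q a', b]\<close>. Then the partial maps extend to
  a bilinear map on all of \<open>A/V(A) \<times> B/V(B)\<close> with values in an abelian overgroup of the pushout. This
  rests on a computation of the kernel of \<open>P \<otimes> V \<oplus> U \<otimes> Q \<rightarrow> P \<otimes> Q\<close> for subgroups \<open>U \<le> P\<close>, \<open>V \<le> Q\<close>: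
  bringing an integer matrix to diagonal form shows that it is generated by the elements
  \<open>(x \<otimes> q y, - q x \<otimes> y)\<close>. The bilinear map serves as the cocycle of a group on \<open>A \<times> B \<times> E\<close>,
  and a quotient of that group contains the amalgam.
\<close>

section \<open>Group-theoretic preliminaries\<close>

lemma comm_group_DirProd:
  assumes "comm_group G" "comm_group H"
  shows "comm_group (G \<times>\<times> H)"
proof -
  interpret G: comm_group G by fact
  interpret H: comm_group H by fact
  interpret GH: group "G \<times>\<times> H" by (rule DirProd_group) unfold_locales
  show ?thesis by (rule GH.group_comm_groupI) (auto simp: G.m_comm H.m_comm)
qed

lemma comm_group_product_group:
  assumes "\<And>i. i \<in> I \<Longrightarrow> comm_group (G i)"
  shows "comm_group (product_group I G)"
proof -
  interpret group "product_group I G"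
    using assms by (intro product_group) (simp add: comm_group_def)
  show ?thesis
    by (rule group_comm_groupI)
      (use assms in \<open>auto intro!: restrict_ext simp: PiE_iff comm_group_def comm_monoid.m_comm\<close>)
qed

lemma nat_pow_DirProd: "(x, y) [^]\<^bsub>G \<times>\<times> H\<^esub> (k :: nat) = (x [^]\<^bsub>G\<^esub> k, y [^]\<^bsub>H\<^esub> k)"
  by (induction k) simp_all

lemma nat_pow_product_group:
  "h [^]\<^bsub>product_group I G\<^esub> (k :: nat) = (\<lambda>i\<in>I. h i [^]\<^bsub>G i\<^esub> k)"
  by (induction k) (auto intro: restrict_ext)

lemma hom_into_product_group:
  assumes "\<And>i. i \<in> I \<Longrightarrow> h i \<in> hom G (H i)"
  shows "(\<lambda>x. \<lambda>i\<in>I. h i x) \<in> hom G (product_group I H)"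
  using assms by (auto simp: hom_def Pi_iff intro!: restrict_ext)

lemma (in comm_group) hom_inv: "h \<in> hom H G \<Longrightarrow> (\<lambda>x. inv h x) \<in> hom H G"
  by (auto simp: hom_def Pi_iff inv_mult)

lemma hom_finprod:
  assumes "comm_group G" "comm_group H" and h: "h \<in> hom G H" and f: "f \<in> I \<rightarrow> carrier G"
  shows "h (finprod G f I) = finprod H (\<lambda>i. h (f i)) I"
proof -
  interpret G: comm_group G by fact
  interpret H: comm_group H by fact
  interpret h: group_hom G H h by unfold_locales (rule h)
  show ?thesis
    using f
  proof (induction I rule: infinite_finite_induct)
    case (insert i I)
    then have "(\<lambda>i. h (f i)) \<in> I \<rightarrow> carrier H" by (auto simp: Pi_iff)
    with insert show ?case by (auto simp: Pi_iff)
  qed auto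
qed

lemma (in group) rcoset_mult_left:
  assumes "subgroup H G" "r \<in> H" "x \<in> carrier G"
  shows "H #> (r \<otimes> x) = H #> x"
  using assms by (metis coset_join2 coset_mult_assoc subgroup.mem_carrier subgroup.subset)

lemma (in group) rcoset_eqE:
  assumes "subgroup H G" "x \<in> carrier G" "y \<in> carrier G" "H #> x = H #> y"
  obtains z where "z \<in> H" "x = z \<otimes> y"
proof -
  have "x \<in> H #> y" using assms(1,2,4) rcos_self[of x H] by simp
  then show thesis using that by (auto simp: r_coset_def)
qed

lemma (in group) subset_set_mult:
  assumes "H \<subseteq> carrier G" "K \<subseteq> carrier G"
  shows "\<one> \<in> K \<Longrightarrow> H \<subseteq> H <#> K" and "\<one> \<in> H \<Longrightarrow> K \<subseteq> H <#> K"
  using assms by (force simp: set_mult_def)+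

lemma (in normal) group_hom_rcoset: "group_hom G (G Mod H) ((#>) H)"
  using factorgroup_is_group r_coset_hom_Mod group_axioms
  by (simp add: group_hom_def group_hom_axioms_def)

lemma (in normal) FactGroup_exponent:
  assumes "\<And>x. x \<in> carrier G \<Longrightarrow> x [^] (n :: nat) = \<one>" and "\<xi> \<in> carrier (G Mod H)"
  shows "\<xi> [^]\<^bsub>G Mod H\<^esub> n = \<one>\<^bsub>G Mod H\<^esub>"
proof -
  obtain x where "x \<in> carrier G" "\<xi> = H #> x" using assms(2) by (auto simp: carrier_FactGroup)
  then show ?thesis using assms(1) by (simp add: FactGroup_pow coset_mult_one subset)
qed

lemma (in group) subgroup_gcd_pow:
  assumes "subgroup H G" "x \<in> carrier G" "x [^] n = \<one>" "x [^] (k :: int) \<in> H"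
  shows "x [^] gcd k (int n) \<in> H"
proof -
  obtain s t where "s * k + t * int n = gcd k (int n)" using bezout_int by blast
  then have "x [^] gcd k (int n) = x [^] (k * s + int n * t)" by (simp add: mult.commute)
  also have "\<dots> = (x [^] k) [^] s \<otimes> (x [^] int n) [^] t"
    using assms by (simp add: int_pow_mult int_pow_pow)
  also have "\<dots> = (x [^] k) [^] s" using assms by (simp add: int_pow_int)
  finally show ?thesis using subgroup_int_pow_closed[OF assms(1,4)] by simp
qed

definition power_product :: "('a, 'r) monoid_scheme \<Rightarrow> ('i \<Rightarrow> 'a) \<Rightarrow> ('i \<Rightarrow> int) \<Rightarrow> 'i set \<Rightarrow> 'a" where
  "power_product G a w I = finprod G (\<lambda>i. a i [^]\<^bsub>G\<^esub> w i) I"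

context comm_group
begin

lemma finprod_remove:
  assumes "finite I" "i \<in> I" "f \<in> I \<rightarrow> carrier G"
  shows "finprod G f I = f i \<otimes> finprod G f (I - {i})"
proof -
  have "finprod G f (insert i (I - {i})) = f i \<otimes> finprod G f (I - {i})"
    using assms by (intro finprod_insert) auto
  then show ?thesis using assms(2) by (simp add: insert_absorb)
qed

lemma power_product_closed [simp]:
  "a \<in> I \<rightarrow> carrier G \<Longrightarrow> power_product G a w I \<in> carrier G"
  unfolding power_product_def by (intro finprod_closed) auto

lemma power_product_cong:
  assumes "b \<in> I \<rightarrow> carrier G" "\<And>i. i \<in> I \<Longrightarrow> a i = b i" "\<And>i. i \<in> I \<Longrightarrow> v i = w i"
  shows "power_product G a v I = power_product G b w I"
  unfolding power_product_def using assms by (intro finprod_cong') auto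

lemma power_product_zero [simp]: "(\<And>i. i \<in> I \<Longrightarrow> w i = 0) \<Longrightarrow> power_product G a w I = \<one>"
  unfolding power_product_def by (intro finprod_one_eqI) simp

lemma power_product_add:
  assumes "a \<in> I \<rightarrow> carrier G"
  shows "power_product G a (\<lambda>i. v i + w i) I = power_product G a v I \<otimes> power_product G a w I"
proof -
  have "finprod G (\<lambda>i. a i [^] (v i + w i)) I = finprod G (\<lambda>i. a i [^] v i \<otimes> a i [^] w i) I"
    using assms by (intro finprod_cong') (auto simp: int_pow_mult Pi_iff)
  also have "\<dots> = finprod G (\<lambda>i. a i [^] v i) I \<otimes> finprod G (\<lambda>i. a i [^] w i) I"
    using assms by (intro finprod_multf) auto
  finally show ?thesis unfolding power_product_def .
qed

lemma power_product_mult: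
  assumes "a \<in> I \<rightarrow> carrier G"
  shows "power_product G a (\<lambda>i. k * w i) I = power_product G a w I [^] k"
proof -
  have "(\<lambda>x. x [^] k) \<in> hom G G" by (auto simp: hom_def int_pow_distrib)
  then have "power_product G a w I [^] k = finprod G (\<lambda>i. (a i [^] w i) [^] k) I"
    unfolding power_product_def using assms
    by (intro hom_finprod[OF comm_group_axioms comm_group_axioms]) auto
  also have "\<dots> = finprod G (\<lambda>i. a i [^] (k * w i)) I"
    using assms by (intro finprod_cong') (auto simp: int_pow_pow mult.commute Pi_iff)
  finally show ?thesis unfolding power_product_def by simp
qed

lemma power_product_remove:
  assumes "finite I" "i \<in> I" "a \<in> I \<rightarrow> carrier G"
  shows "power_product G a w I = a i [^] w i \<otimes> power_product G a w (I - {i})"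
  unfolding power_product_def using assms by (intro finprod_remove) auto

lemma power_product_mono_neutral:
  assumes "finite J" "I \<subseteq> J" "\<And>i. i \<in> J - I \<Longrightarrow> w i = 0" "a \<in> J \<rightarrow> carrier G"
  shows "power_product G a w J = power_product G a w I"
  unfolding power_product_def using assms by (intro finprod_mono_neutral_cong_right) auto

lemma power_product_single:
  assumes "finite I" "i \<in> I" "\<And>j. j \<in> I \<Longrightarrow> j \<noteq> i \<Longrightarrow> w j = 0" "a \<in> I \<rightarrow> carrier G"
  shows "power_product G a w I = a i [^] w i"
proof -
  have "power_product G a w (I - {i}) = \<one>" using assms(3) by (intro power_product_zero) auto
  then show ?thesis using assms power_product_remove[of I i a w] by (auto simp: Pi_iff)
qed

lemma power_product_row_operation:
  assumes I: "finite I" "i \<in> I" and a: "a \<in> I \<rightarrow> carrier G"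
  shows "power_product G (a(i := a i \<otimes> power_product G a k (I - {i})))
      (\<lambda>l. if l = i then w l else w l - k l * w i) I = power_product G a w I"
    (is "power_product G ?a' ?w' I = _")
proof -
  have a_rest: "a \<in> I - {i} \<rightarrow> carrier G" using a by blast
  note closed = power_product_closed[OF a_rest]
  have "power_product G ?a' ?w' I =
    (a i \<otimes> power_product G a k (I - {i})) [^] w i \<otimes> power_product G ?a' ?w' (I - {i})"
    using I a closed by (subst power_product_remove[of I i]) (auto simp: Pi_iff)
  also have "power_product G ?a' ?w' (I - {i}) = power_product G a (\<lambda>l. w l - k l * w i) (I - {i})"
    using a_rest by (intro power_product_cong) auto
  also have "(a i \<otimes> power_product G a k (I - {i})) [^] w i =
      a i [^] w i \<otimes> power_product G a (\<lambda>l. w i * k l) (I - {i})"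
    using I a closed by (simp add: int_pow_distrib power_product_mult[OF a_rest] Pi_iff)
  also have "\<dots> \<otimes> power_product G a (\<lambda>l. w l - k l * w i) (I - {i}) =
      a i [^] w i \<otimes> power_product G a (\<lambda>l. w i * k l + (w l - k l * w i)) (I - {i})"
    using I a closed by (subst power_product_add[OF a_rest]) (simp add: m_assoc Pi_iff)
  also have "\<dots> = a i [^] w i \<otimes> power_product G a w (I - {i})"
    by (simp add: algebra_simps)
  also have "\<dots> = power_product G a w I"
    using I a by (intro power_product_remove[symmetric])
  finally show ?thesis .
qed

end

lemma hom_power_product:
  assumes "comm_group G" "comm_group H" "h \<in> hom G H" "a \<in> I \<rightarrow> carrier G"
  shows "h (power_product G a w I) = power_product H (\<lambda>i. h (a i)) w I"
proof -
  interpret G: comm_group G by fact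
  interpret H: comm_group H by fact
  interpret h: group_hom G H h by unfold_locales fact
  have "h (finprod G (\<lambda>i. a i [^]\<^bsub>G\<^esub> w i) I) = finprod H (\<lambda>i. h (a i [^]\<^bsub>G\<^esub> w i)) I"
    using assms by (intro hom_finprod) auto
  also have "\<dots> = finprod H (\<lambda>i. h (a i) [^]\<^bsub>H\<^esub> w i) I"
    using assms(4) by (intro H.finprod_cong') (auto simp: h.hom_int_pow Pi_iff)
  finally show ?thesis unfolding power_product_def .
qed

section \<open>Bilinear maps\<close>

locale bilinear_map =
  P: group P + Q: group Q + E: comm_group E + U: subgroup U P + V: subgroup V Q
  for P :: "('a, 'r) monoid_scheme" and Q :: "('b, 's) monoid_scheme"
    and E :: "('e, 't) monoid_scheme" and U and V +
  fixes b :: "'a \<Rightarrow> 'b \<Rightarrow> 'e"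
  assumes closed [simp]: "x \<in> U \<Longrightarrow> y \<in> V \<Longrightarrow> b x y \<in> carrier E"
    and mult_left: "x \<in> U \<Longrightarrow> x' \<in> U \<Longrightarrow> y \<in> V \<Longrightarrow> b (x \<otimes>\<^bsub>P\<^esub> x') y = b x y \<otimes>\<^bsub>E\<^esub> b x' y"
    and mult_right: "x \<in> U \<Longrightarrow> y \<in> V \<Longrightarrow> y' \<in> V \<Longrightarrow> b x (y \<otimes>\<^bsub>Q\<^esub> y') = b x y \<otimes>\<^bsub>E\<^esub> b x y'"
begin

lemma swap: "bilinear_map Q P E V U (\<lambda>y x. b x y)"
  by unfold_locales (simp_all add: mult_left mult_right)

lemma group_hom_left:
  assumes "y \<in> V"
  shows "group_hom (P\<lparr>carrier := U\<rparr>) E (\<lambda>x. b x y)"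
proof -
  interpret PU: group "P\<lparr>carrier := U\<rparr>" by (rule U.subgroup_is_group[OF P.group_axioms])
  show ?thesis by unfold_locales (use assms in \<open>auto simp: hom_def mult_left\<close>)
qed

lemma one_left [simp]: "y \<in> V \<Longrightarrow> b \<one>\<^bsub>P\<^esub> y = \<one>\<^bsub>E\<^esub>"
  using group_hom.hom_one[OF group_hom_left] by simp

lemma inv_left: "x \<in> U \<Longrightarrow> y \<in> V \<Longrightarrow> b (inv\<^bsub>P\<^esub> x) y = inv\<^bsub>E\<^esub> b x y"
  using group_hom.hom_inv[OF group_hom_left, of y x] by (simp add: U.subgroup_axioms)

lemma nat_pow_left: "x \<in> U \<Longrightarrow> y \<in> V \<Longrightarrow> b (x [^]\<^bsub>P\<^esub> (k :: nat)) y = b x y [^]\<^bsub>E\<^esub> k"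
  using group_hom.hom_nat_pow[OF group_hom_left, of y x k] by (simp flip: P.nat_pow_consistent)

lemma int_pow_left: "x \<in> U \<Longrightarrow> y \<in> V \<Longrightarrow> b (x [^]\<^bsub>P\<^esub> (k :: int)) y = b x y [^]\<^bsub>E\<^esub> k"
  using group_hom.hom_int_pow[OF group_hom_left, of y x k]
  by (simp flip: P.int_pow_consistent[OF U.subgroup_axioms])

lemmas one_right [simp] = bilinear_map.one_left[OF swap]
  and inv_right = bilinear_map.inv_left[OF swap]
  and nat_pow_right = bilinear_map.nat_pow_left[OF swap]
  and int_pow_right = bilinear_map.int_pow_left[OF swap]

lemma derived_left [simp]:
  assumes "x \<in> derived P U" "y \<in> V"
  shows "b x y = \<one>\<^bsub>E\<^esub>"
proof -
  interpret h: group_hom "P\<lparr>carrier := U\<rparr>" E "\<lambda>x. b x y" by (rule group_hom_left[OF assms(2)])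
  define K where "K = kernel (P\<lparr>carrier := U\<rparr>) E (\<lambda>x. b x y)"
  have "subgroup K P"
    unfolding K_def using P.incl_subgroup[OF U.subgroup_axioms h.subgroup_kernel] .
  moreover have "x \<otimes>\<^bsub>P\<^esub> x' \<otimes>\<^bsub>P\<^esub> inv\<^bsub>P\<^esub> x \<otimes>\<^bsub>P\<^esub> inv\<^bsub>P\<^esub> x' \<in> K" if "x \<in> U" "x' \<in> U" for x x'
  proof -
    have "b (x \<otimes>\<^bsub>P\<^esub> x' \<otimes>\<^bsub>P\<^esub> inv\<^bsub>P\<^esub> x \<otimes>\<^bsub>P\<^esub> inv\<^bsub>P\<^esub> x') y =
        (b x y \<otimes>\<^bsub>E\<^esub> b x' y) \<otimes>\<^bsub>E\<^esub> inv\<^bsub>E\<^esub> (b x y \<otimes>\<^bsub>E\<^esub> b x' y)"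
      using that assms(2) by (simp add: mult_left inv_left E.inv_mult E.m_assoc)
    then show ?thesis using that assms(2) by (simp add: K_def kernel_def)
  qed
  ultimately have "derived P U \<subseteq> K"
    unfolding derived_def by (intro P.generate_subgroup_incl) auto
  then show ?thesis using assms(1) by (auto simp: K_def kernel_def)
qed

lemma left_eq_iff:
  assumes "x \<in> U" "x' \<in> U" "y \<in> V"
  shows "b x y = b x' y \<longleftrightarrow> b (x \<otimes>\<^bsub>P\<^esub> inv\<^bsub>P\<^esub> x') y = \<one>\<^bsub>E\<^esub>"
proof -
  have "b (x \<otimes>\<^bsub>P\<^esub> inv\<^bsub>P\<^esub> x') y = b x y \<otimes>\<^bsub>E\<^esub> inv\<^bsub>E\<^esub> b x' y"
    using assms by (simp add: mult_left inv_left)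
  then show ?thesis using assms E.inv_equality[of "b x y" "inv\<^bsub>E\<^esub> b x' y"] by auto
qed

lemmas right_eq_iff = bilinear_map.left_eq_iff[OF swap]

lemmas derived_right [simp] = bilinear_map.derived_left[OF swap]

lemma compose:
  assumes "group_hom P' P \<phi>" "\<phi> ` carrier P' \<subseteq> U" and "group_hom Q' Q \<psi>" "\<psi> ` carrier Q' \<subseteq> V"
    and "comm_group E'" "\<chi> \<in> hom E E'"
  shows "bilinear_map P' Q' E' (carrier P') (carrier Q') (\<lambda>x y. \<chi> (b (\<phi> x) (\<psi> y)))"
proof -
  interpret \<phi>: group_hom P' P \<phi> by fact
  interpret \<psi>: group_hom Q' Q \<psi> by fact
  interpret E': comm_group E' by fact
  interpret \<chi>: group_hom E E' \<chi> by unfold_locales fact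
  have U: "\<phi> x \<in> U" if "x \<in> carrier P'" for x using that assms(2) by blast
  have V: "\<psi> y \<in> V" if "y \<in> carrier Q'" for y using that assms(4) by blast
  show ?thesis
    by (intro bilinear_map.intro bilinear_map_axioms.intro \<phi>.G.group_axioms \<psi>.G.group_axioms
        E'.comm_group_axioms \<phi>.G.subgroup_self \<psi>.G.subgroup_self)
      (simp_all add: U V mult_left mult_right)
qed

end

lemma bilinear_map_factor:
  assumes b: "bilinear_map G H E (carrier G) (carrier H) b"
    and p: "group_hom G G' p" and q: "group_hom H H' q"
    and ker_p: "\<And>x y. x \<in> carrier G \<Longrightarrow> p x = \<one>\<^bsub>G'\<^esub> \<Longrightarrow> y \<in> carrier H \<Longrightarrow> b x y = \<one>\<^bsub>E\<^esub>"
    and ker_q: "\<And>x y. x \<in> carrier G \<Longrightarrow> y \<in> carrier H \<Longrightarrow> q y = \<one>\<^bsub>H'\<^esub> \<Longrightarrow> b x y = \<one>\<^bsub>E\<^esub>"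
  obtains b' where "bilinear_map G' H' E (p ` carrier G) (q ` carrier H) b'"
    and "\<And>x y. x \<in> carrier G \<Longrightarrow> y \<in> carrier H \<Longrightarrow> b' (p x) (q y) = b x y"
proof -
  interpret b: bilinear_map G H E "carrier G" "carrier H" b by (rule b)
  interpret p: group_hom G G' p by (rule p)
  interpret q: group_hom H H' q by (rule q)
  have left: "b x y = b x' y"
    if "x \<in> carrier G" "x' \<in> carrier G" "p x = p x'" "y \<in> carrier H" for x x' y
    using that by (subst b.left_eq_iff) (auto intro: ker_p)
  have right: "b x y = b x y'"
    if "x \<in> carrier G" "y \<in> carrier H" "y' \<in> carrier H" "q y = q y'" for x y y'
    using that by (subst b.right_eq_iff) (auto intro: ker_q)
  define b' where "b' \<xi> \<eta> = b (inv_into (carrier G) p \<xi>) (inv_into (carrier H) q \<eta>)" for \<xi> \<eta>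
  have b'_eq: "b' (p x) (q y) = b x y" if "x \<in> carrier G" "y \<in> carrier H" for x y
  proof -
    have "inv_into (carrier G) p (p x) \<in> carrier G" "p (inv_into (carrier G) p (p x)) = p x"
      "inv_into (carrier H) q (q y) \<in> carrier H" "q (inv_into (carrier H) q (q y)) = q y"
      using that by (auto intro: inv_into_into f_inv_into_f)
    then show ?thesis unfolding b'_def using that left right by metis
  qed
  have "bilinear_map G' H' E (p ` carrier G) (q ` carrier H) b'"
  proof (intro bilinear_map.intro bilinear_map_axioms.intro p.H.group_axioms q.H.group_axioms
      b.E.comm_group_axioms p.img_is_subgroup q.img_is_subgroup)
    fix \<xi> \<xi>' \<eta> assume "\<xi> \<in> p ` carrier G" "\<xi>' \<in> p ` carrier G" "\<eta> \<in> q ` carrier H"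
    then show "b' (\<xi> \<otimes>\<^bsub>G'\<^esub> \<xi>') \<eta> = b' \<xi> \<eta> \<otimes>\<^bsub>E\<^esub> b' \<xi>' \<eta>"
      by (auto simp: b'_eq b.mult_left simp flip: p.hom_mult)
  next
    fix \<xi> \<eta> \<eta>' assume "\<xi> \<in> p ` carrier G" "\<eta> \<in> q ` carrier H" "\<eta>' \<in> q ` carrier H"
    then show "b' \<xi> (\<eta> \<otimes>\<^bsub>H'\<^esub> \<eta>') = b' \<xi> \<eta> \<otimes>\<^bsub>E\<^esub> b' \<xi> \<eta>'"
      by (auto simp: b'_eq b.mult_right simp flip: q.hom_mult)
  qed (auto simp: b'_eq)
  with b'_eq show thesis by (rule that[rotated])
qed

section \<open>Integer matrices and pairs of partial bilinear maps\<close>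

locale partial_bilinear_maps =
  P: comm_group P + Q: comm_group Q + C: comm_group C + U: subgroup U P + V: subgroup V Q +
  f: bilinear_map P Q C "carrier P" V f + g: bilinear_map P Q C U "carrier Q" g
  for P :: "('x, 'r) monoid_scheme" and Q :: "('y, 's) monoid_scheme"
    and C :: "('c, 't) monoid_scheme" and U and V and f and g +
  fixes n :: nat
  assumes compatible: "q > 0 \<Longrightarrow> q dvd n \<Longrightarrow> x \<in> carrier P \<Longrightarrow> y \<in> carrier Q \<Longrightarrow>
      x [^]\<^bsub>P\<^esub> q \<in> U \<Longrightarrow> y [^]\<^bsub>Q\<^esub> q \<in> V \<Longrightarrow> f x (y [^]\<^bsub>Q\<^esub> q) = g (x [^]\<^bsub>P\<^esub> q) y"
    and exponent_P: "x \<in> carrier P \<Longrightarrow> x [^]\<^bsub>P\<^esub> n = \<one>\<^bsub>P\<^esub>"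
    and exponent_Q: "y \<in> carrier Q \<Longrightarrow> y [^]\<^bsub>Q\<^esub> n = \<one>\<^bsub>Q\<^esub>"
begin

lemma swap: "partial_bilinear_maps Q P C V U (\<lambda>y x. g x y) (\<lambda>y x. f x y) n"
  by (intro partial_bilinear_maps.intro partial_bilinear_maps_axioms.intro f.swap g.swap
      P.comm_group_axioms Q.comm_group_axioms C.comm_group_axioms
      U.subgroup_axioms V.subgroup_axioms)
    (simp_all add: compatible exponent_P exponent_Q)

lemma V_int_pow: "v \<in> V \<Longrightarrow> v [^]\<^bsub>Q\<^esub> (k :: int) \<in> V"
  using Q.subgroup_int_pow_closed[OF V.subgroup_axioms] .

lemma compatible_int:
  assumes x: "x \<in> carrier P" and y: "y \<in> carrier Q"
    and xk: "x [^]\<^bsub>P\<^esub> (k :: int) \<in> U" and yk: "y [^]\<^bsub>Q\<^esub> k \<in> V"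
  shows "f x (y [^]\<^bsub>Q\<^esub> k) = g (x [^]\<^bsub>P\<^esub> k) y"
proof (cases "k = 0")
  case True
  then show ?thesis using x y by simp
next
  case False
  define q where "q = nat (gcd k (int n))"
  have q: "int q = gcd k (int n)" by (simp add: q_def)
  have "q > 0" using False by (simp add: q_def)
  have "int q dvd int n" using q by simp
  then have "q dvd n" by simp
  obtain r where r: "k = int q * r" using q by (metis dvd_def gcd_dvd1)
  have xq: "x [^]\<^bsub>P\<^esub> int q \<in> U"
    using P.subgroup_gcd_pow[OF U.subgroup_axioms x exponent_P[OF x] xk] q by simp
  have yq: "y [^]\<^bsub>Q\<^esub> int q \<in> V"
    using Q.subgroup_gcd_pow[OF V.subgroup_axioms y exponent_Q[OF y] yk] q by simp
  have "f x (y [^]\<^bsub>Q\<^esub> int q) = g (x [^]\<^bsub>P\<^esub> int q) y"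
    using compatible[OF \<open>q > 0\<close> \<open>q dvd n\<close> x y] xq yq by (simp add: int_pow_int)
  then have "f x ((y [^]\<^bsub>Q\<^esub> int q) [^]\<^bsub>Q\<^esub> r) = g ((x [^]\<^bsub>P\<^esub> int q) [^]\<^bsub>P\<^esub> r) y"
    using x y xq yq by (simp add: f.int_pow_right g.int_pow_left)
  then show ?thesis using x y r by (simp add: P.int_pow_pow Q.int_pow_pow)
qed

text \<open>The two evaluations of \<open>\<Sum>\<^sub>i\<^sub>s w i s (a i \<otimes> y s)\<close>, by rows through \<open>f\<close> and by columns through
  \<open>g\<close>, agree. The property is invariant under row and column operations on \<open>w\<close>, since these can be
  compensated by a change of \<open>a\<close> or \<open>y\<close>, and for a single entry it is \<open>compatible_int\<close>.\<close>

definition balanced :: "'i set \<Rightarrow> 'j set \<Rightarrow> ('i \<Rightarrow> 'j \<Rightarrow> int) \<Rightarrow> bool" where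
  "balanced I J w \<longleftrightarrow> (\<forall>a y. a \<in> I \<rightarrow> carrier P \<longrightarrow> y \<in> J \<rightarrow> carrier Q \<longrightarrow>
     (\<forall>s\<in>J. power_product P a (\<lambda>i. w i s) I \<in> U) \<longrightarrow> (\<forall>i\<in>I. power_product Q y (w i) J \<in> V) \<longrightarrow>
     finprod C (\<lambda>i. f (a i) (power_product Q y (w i) J)) I =
     finprod C (\<lambda>s. g (power_product P a (\<lambda>i. w i s) I) (y s)) J)"

lemma balancedI:
  assumes "\<And>a y. a \<in> I \<rightarrow> carrier P \<Longrightarrow> y \<in> J \<rightarrow> carrier Q \<Longrightarrow>
      (\<And>s. s \<in> J \<Longrightarrow> power_product P a (\<lambda>i. w i s) I \<in> U) \<Longrightarrow>
      (\<And>i. i \<in> I \<Longrightarrow> power_product Q y (w i) J \<in> V) \<Longrightarrow>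
      finprod C (\<lambda>i. f (a i) (power_product Q y (w i) J)) I =
      finprod C (\<lambda>s. g (power_product P a (\<lambda>i. w i s) I) (y s)) J"
  shows "balanced I J w"
  unfolding balanced_def using assms by blast

lemma balancedD:
  assumes "balanced I J w" "a \<in> I \<rightarrow> carrier P" "y \<in> J \<rightarrow> carrier Q"
    and "\<And>s. s \<in> J \<Longrightarrow> power_product P a (\<lambda>i. w i s) I \<in> U"
    and "\<And>i. i \<in> I \<Longrightarrow> power_product Q y (w i) J \<in> V"
  shows "finprod C (\<lambda>i. f (a i) (power_product Q y (w i) J)) I =
    finprod C (\<lambda>s. g (power_product P a (\<lambda>i. w i s) I) (y s)) J"
  using assms unfolding balanced_def by blast

lemma balanced_swap:
  "balanced I J w \<longleftrightarrow>
    partial_bilinear_maps.balanced Q P C V U (\<lambda>y x. g x y) (\<lambda>y x. f x y) J I (\<lambda>s i. w i s)"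
proof -
  interpret swapped: partial_bilinear_maps Q P C V U "\<lambda>y x. g x y" "\<lambda>y x. f x y" n by (rule swap)
  show ?thesis unfolding balanced_def swapped.balanced_def by (subst eq_commute) blast
qed

lemma finprod_f_row_operation:
  assumes I: "finite I" "i \<in> I" and a: "a \<in> I \<rightarrow> carrier P" and \<rho>: "\<rho> \<in> I \<rightarrow> V"
  shows "finprod C (\<lambda>l. f ((a(i := a i \<otimes>\<^bsub>P\<^esub> power_product P a k (I - {i}))) l)
      (if l = i then \<rho> l else \<rho> l \<otimes>\<^bsub>Q\<^esub> \<rho> i [^]\<^bsub>Q\<^esub> (- k l))) I = finprod C (\<lambda>l. f (a l) (\<rho> l)) I"
    (is "finprod C ?F I = _")
proof -
  let ?R = "I - {i}"
  let ?h = "\<lambda>l. f (a l) (\<rho> i)"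
  have a': "a l \<in> carrier P" and \<rho>': "\<rho> l \<in> V" if "l \<in> I" for l using that a \<rho> by auto
  have h: "?h \<in> ?R \<rightarrow> carrier C" using a' \<rho>' I(2) by auto
  have rest: "(\<lambda>l. f (a l) (\<rho> l)) \<in> ?R \<rightarrow> carrier C" using a' \<rho>' by auto
  have "(\<lambda>x. f x (\<rho> i)) \<in> hom P C" using \<rho>' I(2) by (auto simp: hom_def f.mult_left)
  then have hom: "f (power_product P a k ?R) (\<rho> i) = power_product C ?h k ?R"
    using a' by (intro hom_power_product[OF P.comm_group_axioms C.comm_group_axioms]) auto
  have "finprod C ?F I = ?F i \<otimes>\<^bsub>C\<^esub> finprod C ?F ?R"
    using I a' \<rho>' by (intro C.finprod_remove) (auto simp: V_int_pow)
  also have "?F i = f (a i) (\<rho> i) \<otimes>\<^bsub>C\<^esub> power_product C ?h k ?R"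
    using I a' \<rho>' by (simp add: f.mult_left hom)
  also have "finprod C ?F ?R = finprod C (\<lambda>l. f (a l) (\<rho> l) \<otimes>\<^bsub>C\<^esub> ?h l [^]\<^bsub>C\<^esub> (- k l)) ?R"
    using I(2) a' \<rho>' by (intro C.finprod_cong') (auto simp: f.mult_right f.int_pow_right V_int_pow)
  also have "\<dots> = finprod C (\<lambda>l. f (a l) (\<rho> l)) ?R \<otimes>\<^bsub>C\<^esub> power_product C ?h (\<lambda>l. - k l) ?R"
    unfolding power_product_def using I(2) a' \<rho>' by (intro C.finprod_multf) auto
  also have "f (a i) (\<rho> i) \<otimes>\<^bsub>C\<^esub> power_product C ?h k ?R \<otimes>\<^bsub>C\<^esub> \<dots> =
      f (a i) (\<rho> i) \<otimes>\<^bsub>C\<^esub> finprod C (\<lambda>l. f (a l) (\<rho> l)) ?R \<otimes>\<^bsub>C\<^esub>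
      (power_product C ?h k ?R \<otimes>\<^bsub>C\<^esub> power_product C ?h (\<lambda>l. - k l) ?R)"
    using I(2) a' \<rho>' C.power_product_closed[OF h] C.finprod_closed[OF rest] by (simp add: C.m_ac)
  also have "power_product C ?h k ?R \<otimes>\<^bsub>C\<^esub> power_product C ?h (\<lambda>l. - k l) ?R = \<one>\<^bsub>C\<^esub>"
    by (simp flip: C.power_product_add[OF h])
  also have "f (a i) (\<rho> i) \<otimes>\<^bsub>C\<^esub> finprod C (\<lambda>l. f (a l) (\<rho> l)) ?R \<otimes>\<^bsub>C\<^esub> \<one>\<^bsub>C\<^esub> =
      finprod C (\<lambda>l. f (a l) (\<rho> l)) I"
    using I a' \<rho>' C.finprod_closed[OF rest] by (subst C.finprod_remove[of I i]) auto
  finally show ?thesis .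
qed

lemma balanced_row_operation:
  assumes I: "finite I" "i \<in> I"
    and bal: "balanced I J (\<lambda>l t. if l = i then w l t else w l t - k l * w i t)"
  shows "balanced I J w"
proof (rule balancedI)
  fix a y
  assume a: "a \<in> I \<rightarrow> carrier P" and y: "y \<in> J \<rightarrow> carrier Q"
    and col: "\<And>s. s \<in> J \<Longrightarrow> power_product P a (\<lambda>i. w i s) I \<in> U"
    and row: "\<And>i. i \<in> I \<Longrightarrow> power_product Q y (w i) J \<in> V"
  define w' where "w' l = (\<lambda>t. if l = i then w l t else w l t - k l * w i t)" for l
  define a' where "a' = a(i := a i \<otimes>\<^bsub>P\<^esub> power_product P a k (I - {i}))"
  define \<rho> where "\<rho> l = power_product Q y (w l) J" for l
  have \<rho>: "\<rho> \<in> I \<rightarrow> V" using row by (simp add: \<rho>_def)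
  have "a \<in> I - {i} \<rightarrow> carrier P" using a by blast
  then have a': "a' \<in> I \<rightarrow> carrier P"
    using a I(2) P.power_product_closed[of a "I - {i}" k] by (simp add: a'_def Pi_iff)
  have col': "power_product P a' (\<lambda>l. w' l s) I = power_product P a (\<lambda>l. w l s) I" for s
    unfolding a'_def w'_def by (rule P.power_product_row_operation[OF I a])
  have row': "power_product Q y (w' l) J = (if l = i then \<rho> l else \<rho> l \<otimes>\<^bsub>Q\<^esub> \<rho> i [^]\<^bsub>Q\<^esub> (- k l))"
    for l
    using Q.power_product_add[OF y, of "w l" "\<lambda>t. - k l * w i t"]
      Q.power_product_mult[OF y, of "- k l" "w i"]
    by (simp add: w'_def \<rho>_def)
  have "power_product Q y (w' l) J \<in> V" if "l \<in> I" for l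
    using \<rho> I(2) that V_int_pow by (auto simp: row')
  moreover have "balanced I J w'" using bal by (simp add: w'_def[abs_def])
  ultimately have "finprod C (\<lambda>i. f (a' i) (power_product Q y (w' i) J)) I =
      finprod C (\<lambda>s. g (power_product P a' (\<lambda>i. w' i s) I) (y s)) J"
    using a' y col by (intro balancedD) (simp_all only: col')
  then show "finprod C (\<lambda>i. f (a i) (power_product Q y (w i) J)) I =
      finprod C (\<lambda>s. g (power_product P a (\<lambda>i. w i s) I) (y s)) J"
    using finprod_f_row_operation[OF I a \<rho>, of k, folded a'_def] by (simp add: row' col' \<rho>_def)
qed

lemma balanced_isolated_entry:
  assumes fin: "finite I" "finite J" and ij: "i \<in> I" "s \<in> J"
    and row_zero: "\<And>t. t \<in> J \<Longrightarrow> t \<noteq> s \<Longrightarrow> w i t = 0" and col_zero: "\<And>l. l \<in> I \<Longrightarrow> l \<noteq> i \<Longrightarrow> w l s = 0"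
    and bal: "balanced (I - {i}) (J - {s}) w"
  shows "balanced I J w"
proof (rule balancedI)
  fix a y
  assume a: "a \<in> I \<rightarrow> carrier P" and y: "y \<in> J \<rightarrow> carrier Q"
    and col: "\<And>s. s \<in> J \<Longrightarrow> power_product P a (\<lambda>i. w i s) I \<in> U"
    and row: "\<And>i. i \<in> I \<Longrightarrow> power_product Q y (w i) J \<in> V"
  have row_i: "power_product Q y (w i) J = y s [^]\<^bsub>Q\<^esub> w i s"
    using fin ij y row_zero by (intro Q.power_product_single) auto
  have col_s: "power_product P a (\<lambda>l. w l s) I = a i [^]\<^bsub>P\<^esub> w i s"
    using fin ij a col_zero by (intro P.power_product_single) auto
  have row_rest: "power_product Q y (w l) J = power_product Q y (w l) (J - {s})"
    if "l \<in> I - {i}" for l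
    using fin y that col_zero by (intro Q.power_product_mono_neutral) auto
  have col_rest: "power_product P a (\<lambda>l. w l t) I = power_product P a (\<lambda>l. w l t) (I - {i})"
    if "t \<in> J - {s}" for t
    using fin a that row_zero by (intro P.power_product_mono_neutral) auto
  let ?F = "\<lambda>l. f (a l) (power_product Q y (w l) J)"
  let ?G = "\<lambda>t. g (power_product P a (\<lambda>l. w l t) I) (y t)"
  have F: "?F \<in> I \<rightarrow> carrier C" using a row by (simp add: Pi_iff)
  have G: "?G \<in> J \<rightarrow> carrier C" using y col by (simp add: Pi_iff)
  have "finprod C ?F I = ?F i \<otimes>\<^bsub>C\<^esub> finprod C ?F (I - {i})"
    using fin ij F by (intro C.finprod_remove)
  also have "?F i = ?G s"
    unfolding row_i col_s using ij a y row[of i] col[of s] row_i col_s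
    by (intro compatible_int) auto
  also have "finprod C ?F (I - {i}) =
      finprod C (\<lambda>l. f (a l) (power_product Q y (w l) (J - {s}))) (I - {i})"
    using F by (intro C.finprod_cong') (simp_all add: Pi_iff flip: row_rest)
  also have "\<dots> = finprod C (\<lambda>t. g (power_product P a (\<lambda>l. w l t) (I - {i})) (y t)) (J - {s})"
    using a y row col by (intro balancedD[OF bal]) (auto simp flip: row_rest col_rest)
  also have "\<dots> = finprod C ?G (J - {s})"
    using G by (intro C.finprod_cong') (auto simp: col_rest)
  also have "?G s \<otimes>\<^bsub>C\<^esub> finprod C ?G (J - {s}) = finprod C ?G J"
    using fin ij G by (intro C.finprod_remove[symmetric])
  finally show "finprod C ?F I = finprod C ?G J" .
qed

lemma balanced_zero:
  assumes "\<And>i s. i \<in> I \<Longrightarrow> s \<in> J \<Longrightarrow> w i s = 0"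
  shows "balanced I J w"
proof (rule balancedI)
  fix a y
  assume a: "a \<in> I \<rightarrow> carrier P" and y: "y \<in> J \<rightarrow> carrier Q"
  have "finprod C (\<lambda>i. f (a i) (power_product Q y (w i) J)) I = \<one>\<^bsub>C\<^esub>"
    using assms a by (intro C.finprod_one_eqI) (auto simp: Pi_iff)
  moreover have "finprod C (\<lambda>s. g (power_product P a (\<lambda>i. w i s) I) (y s)) J = \<one>\<^bsub>C\<^esub>"
    using assms y by (intro C.finprod_one_eqI) (auto simp: Pi_iff)
  ultimately show "finprod C (\<lambda>i. f (a i) (power_product Q y (w i) J)) I =
      finprod C (\<lambda>s. g (power_product P a (\<lambda>i. w i s) I) (y s)) J" by simp
qed

lemma balanced_clear_column:
  assumes I: "finite I" "i \<in> I" and pivot: "w i s \<noteq> 0"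
    and smaller: "\<And>w' l. l \<in> I \<Longrightarrow> w' l s \<noteq> 0 \<Longrightarrow> \<bar>w' l s\<bar> < \<bar>w i s\<bar> \<Longrightarrow> balanced I J w'"
    and cleared: "\<And>w'. w' i = w i \<Longrightarrow> (\<And>l. l \<in> I \<Longrightarrow> l \<noteq> i \<Longrightarrow> w' l s = 0) \<Longrightarrow> balanced I J w'"
  shows "balanced I J w"
proof (rule balanced_row_operation[OF I])
  define w' where "w' l t = (if l = i then w l t else w l t - w l s div w i s * w i t)" for l t
  have remainder: "w' l s = w l s mod w i s" if "l \<noteq> i" for l
    using that by (simp add: w'_def minus_div_mult_eq_mod)
  have "balanced I J w'"
  proof (cases "\<exists>l\<in>I. l \<noteq> i \<and> w' l s \<noteq> 0")
    case True
    then obtain l where l: "l \<in> I" "l \<noteq> i" "w' l s \<noteq> 0" by blast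
    then show ?thesis using abs_mod_less[OF pivot] remainder by (intro smaller) auto
  next
    case False
    moreover have "w' i = w i" by (simp add: w'_def fun_eq_iff)
    ultimately show ?thesis by (intro cleared) auto
  qed
  then show "balanced I J (\<lambda>l t. if l = i then w l t else w l t - w l s div w i s * w i t)"
    by (simp add: w'_def[abs_def])
qed

lemma balanced_pivot:
  assumes fin: "finite I" "finite J"
    and minor: "\<And>i s w. i \<in> I \<Longrightarrow> s \<in> J \<Longrightarrow> balanced (I - {i}) (J - {s}) w"
    and "i \<in> I" "s \<in> J" "w i s \<noteq> 0"
  shows "balanced I J w"
  using assms(4-)
proof (induction "nat \<bar>w i s\<bar>" arbitrary: i s w rule: less_induct)
  case (less i s w)
  interpret swapped: partial_bilinear_maps Q P C V U "\<lambda>y x. g x y" "\<lambda>y x. f x y" n by (rule swap)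
  have smaller: "balanced I J w'" if "l \<in> I" "t \<in> J" "w' l t \<noteq> 0" "\<bar>w' l t\<bar> < \<bar>w i s\<bar>" for w' l t
    using that less.prems(3) by (intro less.hyps[of w' l t]) auto
  show ?case
  proof (rule balanced_clear_column[of I i w s, OF fin(1) less.prems(1,3)])
    fix w1 assume w1: "w1 i = w i" "\<And>l. l \<in> I \<Longrightarrow> l \<noteq> i \<Longrightarrow> w1 l s = 0"
    have "swapped.balanced J I (\<lambda>t l. w1 l t)"
    proof (rule swapped.balanced_clear_column[of J s _ i, OF fin(2) less.prems(2)])
      fix w2 assume w2: "w2 s = (\<lambda>l. w1 l s)" "\<And>t. t \<in> J \<Longrightarrow> t \<noteq> s \<Longrightarrow> w2 t i = 0"
      have "balanced I J (\<lambda>l t. w2 t l)"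
        using w1 w2 less.prems minor fin by (intro balanced_isolated_entry[of I J i s]) auto
      then show "swapped.balanced J I w2" by (simp add: balanced_swap)
    qed (use w1 less.prems smaller in \<open>auto simp: balanced_swap\<close>)
    then show "balanced I J w1" by (simp add: balanced_swap)
  qed (use less.prems smaller in auto)
qed

lemma balanced_all:
  assumes "finite I" "finite J"
  shows "balanced I J w"
  using assms
proof (induction "card I" arbitrary: I J w rule: less_induct)
  case (less I J w)
  show ?case
  proof (cases "\<forall>i\<in>I. \<forall>s\<in>J. w i s = 0")
    case True
    then show ?thesis by (intro balanced_zero) auto
  next
    case False
    then obtain i s where pivot: "i \<in> I" "s \<in> J" "w i s \<noteq> 0" by blast
    have "balanced (I - {l}) (J - {t}) w" if "l \<in> I" for l t w
      using that less.prems by (intro less.hyps card_Diff1_less) auto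
    then show ?thesis using less.prems pivot by (intro balanced_pivot[of I J i s]) auto
  qed
qed

end

section \<open>Extension of partial bilinear maps\<close>

definition delta :: "'i set \<Rightarrow> ('a, 'r) monoid_scheme \<Rightarrow> 'i \<Rightarrow> 'a \<Rightarrow> 'i \<Rightarrow> 'a" where
  "delta I G j x = (\<lambda>i\<in>I. if i = j then x else \<one>\<^bsub>G\<^esub>)"

lemma delta_in_sum_group:
  assumes "group G" "x \<in> carrier G"
  shows "delta I G j x \<in> carrier (sum_group I (\<lambda>_. G))"
proof -
  have "{i \<in> I. delta I G j x i \<noteq> \<one>\<^bsub>G\<^esub>} \<subseteq> {j}" by (auto simp: delta_def)
  then have "finite {i \<in> I. delta I G j x i \<noteq> \<one>\<^bsub>G\<^esub>}" by (rule finite_subset) simp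
  then show ?thesis
    using assms by (auto simp: carrier_sum_group delta_def group.is_monoid monoid.one_closed)
qed

context comm_monoid
begin

lemma gfinprod_eq_finprod_support:
  assumes "finite I" "I \<subseteq> A" "\<And>i. i \<in> A - I \<Longrightarrow> h i = \<one>" "h \<in> A \<rightarrow> carrier G"
  shows "gfinprod G h A = finprod G h I"
proof -
  have "gfinprod G h A = gfinprod G h I"
    using assms by (intro gfinprod_mono_neutral_cong_right) auto
  also have "h \<in> I \<rightarrow> carrier G" using assms by auto
  with assms(1) have "gfinprod G h I = finprod G h I" by (rule gfinprod_eq_finprod)
  finally show ?thesis .
qed

lemma gfinprod_delta:
  assumes "j \<in> I" "h j x \<in> carrier G" "\<And>i. i \<in> I \<Longrightarrow> h i \<one>\<^bsub>H\<^esub> = \<one>"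
  shows "gfinprod G (\<lambda>i. h i (delta I H j x i)) I = h j x"
proof -
  have "gfinprod G (\<lambda>i. h i (delta I H j x i)) I = finprod G (\<lambda>i. h i (delta I H j x i)) {j}"
    using assms by (intro gfinprod_eq_finprod_support) (auto simp: delta_def)
  then show ?thesis using assms by (simp add: delta_def)
qed

end

context partial_bilinear_maps
begin

definition weighted_sum :: "('y \<Rightarrow>\<^sub>0 int) \<Rightarrow> 'y" where
  "weighted_sum w = power_product Q (\<lambda>s. s) (Poly_Mapping.lookup w) (Poly_Mapping.keys w)"

lemma weighted_sum_eq:
  assumes "finite J" "Poly_Mapping.keys w \<subseteq> J" "J \<subseteq> carrier Q"
  shows "weighted_sum w = power_product Q (\<lambda>s. s) (Poly_Mapping.lookup w) J"
  unfolding weighted_sum_def using assms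
  by (intro Q.power_product_mono_neutral[symmetric]) (auto simp: in_keys_iff)

lemma weighted_sum_add:
  assumes "Poly_Mapping.keys v \<subseteq> carrier Q" "Poly_Mapping.keys w \<subseteq> carrier Q"
  shows "weighted_sum (v + w) = weighted_sum v \<otimes>\<^bsub>Q\<^esub> weighted_sum w"
proof -
  let ?J = "Poly_Mapping.keys v \<union> Poly_Mapping.keys w"
  have J: "finite ?J" "?J \<subseteq> carrier Q" using assms by auto
  have "weighted_sum (v + w) = power_product Q (\<lambda>s. s) (Poly_Mapping.lookup (v + w)) ?J"
    using J keys_add[of v w] by (intro weighted_sum_eq)
  also have "\<dots> = power_product Q (\<lambda>s. s) (Poly_Mapping.lookup v) ?J \<otimes>\<^bsub>Q\<^esub>
      power_product Q (\<lambda>s. s) (Poly_Mapping.lookup w) ?J"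
    using J by (subst Q.power_product_add[symmetric])
      (auto simp: lookup_add plus_poly_mapping.rep_eq)
  also have "\<dots> = weighted_sum v \<otimes>\<^bsub>Q\<^esub> weighted_sum w" using J by (simp add: weighted_sum_eq[of ?J])
  finally show ?thesis .
qed

lemma weighted_sum_frag_of: "y \<in> carrier Q \<Longrightarrow> weighted_sum (frag_of y) = y"
  unfolding weighted_sum_def by (subst Q.power_product_single[of _ y]) auto

definition weights :: "('y \<Rightarrow>\<^sub>0 int) set" where
  "weights = {w. Poly_Mapping.keys w \<subseteq> carrier Q \<and> weighted_sum w \<in> V}"

text \<open>A pair \<open>(h, c)\<close> stands for \<open>\<Sum>\<^sub>s (h s \<otimes> s) + c\<close>, an element of \<open>P \<otimes> \<int>[Q] \<oplus> C\<close>. The extension is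
  its quotient by the relations \<open>\<Sum>\<^sub>s w s (x \<otimes> s) = f x (\<Sum>\<^sub>s w s s)\<close> for the integer weights \<open>w\<close> with
  \<open>\<Sum>\<^sub>s w s s \<in> V\<close>, and \<open>u \<otimes> s = g u s\<close>. Additivity in the second argument is the case of the former
  where \<open>\<Sum>\<^sub>s w s s = 0\<close>. A family \<open>\<phi>\<close> of coefficients of these relations makes \<open>w\<close> a matrix.\<close>

definition formal_sums :: "(('y \<Rightarrow> 'x) \<times> 'c) monoid" where
  "formal_sums = product_group (carrier Q) (\<lambda>_. P) \<times>\<times> C"

definition f_relator :: "(('y \<Rightarrow>\<^sub>0 int) \<Rightarrow> 'x) \<Rightarrow> ('y \<Rightarrow> 'x) \<times> 'c" where
  "f_relator \<phi> =
     (\<lambda>s\<in>carrier Q. gfinprod P (\<lambda>w. \<phi> w [^]\<^bsub>P\<^esub> Poly_Mapping.lookup w s) weights,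
      inv\<^bsub>C\<^esub> gfinprod C (\<lambda>w. f (\<phi> w) (weighted_sum w)) weights)"

definition g_relator :: "('y \<Rightarrow> 'x) \<Rightarrow> ('y \<Rightarrow> 'x) \<times> 'c" where
  "g_relator \<tau> = (\<tau>, inv\<^bsub>C\<^esub> gfinprod C (\<lambda>s. g (\<tau> s) s) (carrier Q))"

abbreviation f_coefficients :: "(('y \<Rightarrow>\<^sub>0 int) \<Rightarrow> 'x) monoid" where
  "f_coefficients \<equiv> sum_group weights (\<lambda>_. P)"

abbreviation g_coefficients :: "('y \<Rightarrow> 'x) monoid" where
  "g_coefficients \<equiv> sum_group (carrier Q) (\<lambda>_. P\<lparr>carrier := U\<rparr>)"

definition relators :: "(('y \<Rightarrow> 'x) \<times> 'c) set" where
  "relators =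
     f_relator ` carrier f_coefficients <#>\<^bsub>formal_sums\<^esub> g_relator ` carrier g_coefficients"

sublocale formal_sums: comm_group formal_sums
  unfolding formal_sums_def
  by (intro comm_group_DirProd comm_group_product_group P.comm_group_axioms C.comm_group_axioms)

lemma formal_sums_simps [simp]:
  "carrier formal_sums = (carrier Q \<rightarrow>\<^sub>E carrier P) \<times> carrier C"
  "\<one>\<^bsub>formal_sums\<^esub> = (\<lambda>s\<in>carrier Q. \<one>\<^bsub>P\<^esub>, \<one>\<^bsub>C\<^esub>)"
  "(h, c) \<otimes>\<^bsub>formal_sums\<^esub> (h', c') = (\<lambda>s\<in>carrier Q. h s \<otimes>\<^bsub>P\<^esub> h' s, c \<otimes>\<^bsub>C\<^esub> c')"
  by (simp_all add: formal_sums_def)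

lemma group_U: "group (P\<lparr>carrier := U\<rparr>)"
  by (rule U.subgroup_is_group[OF P.group_axioms])

lemma group_hom_f_relator: "group_hom f_coefficients formal_sums f_relator"
proof -
  have "(\<lambda>\<phi>. gfinprod P (\<lambda>w. \<phi> w [^]\<^bsub>P\<^esub> Poly_Mapping.lookup w s) weights) \<in> hom f_coefficients P"
    for s
    by (rule P.hom_group_sum[where f = "\<lambda>w x. x [^]\<^bsub>P\<^esub> Poly_Mapping.lookup w s"])
      (auto simp: hom_def P.int_pow_distrib)
  moreover have "(\<lambda>\<phi>. gfinprod C (\<lambda>w. f (\<phi> w) (weighted_sum w)) weights) \<in> hom f_coefficients C"
    by (rule C.hom_group_sum[where f = "\<lambda>w x. f x (weighted_sum w)"])
      (auto simp: hom_def weights_def f.mult_left)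
  ultimately have "f_relator \<in> hom f_coefficients formal_sums"
    unfolding f_relator_def[abs_def] formal_sums_def hom_paired
    by (intro conjI hom_into_product_group C.hom_inv)
  then show ?thesis
    by (simp add: group_hom_def group_hom_axioms_def formal_sums.group_axioms)
qed

lemma group_hom_g_relator: "group_hom g_coefficients formal_sums g_relator"
proof -
  have "(\<lambda>\<tau>. \<tau>) \<in> hom g_coefficients (product_group (carrier Q) (\<lambda>_. P))"
    using U.subset by (auto simp: hom_def carrier_sum_group group_U PiE_iff)
  moreover have "(\<lambda>\<tau>. gfinprod C (\<lambda>s. g (\<tau> s) s) (carrier Q)) \<in> hom g_coefficients C"
    by (rule C.hom_group_sum[where f = "\<lambda>s u. g u s"]) (auto simp: hom_def g.mult_left group_U)
  ultimately have "g_relator \<in> hom g_coefficients formal_sums"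
    unfolding g_relator_def[abs_def] formal_sums_def hom_paired by (intro conjI C.hom_inv)
  then show ?thesis
    by (simp add: group_hom_def group_hom_axioms_def formal_sums.group_axioms group_U)
qed

lemma subgroup_relators: "subgroup relators formal_sums"
  unfolding relators_def
  by (intro formal_sums.mult_subgroups group_hom.img_is_subgroup
      group_hom_f_relator group_hom_g_relator)

lemma f_relator_in_relators:
  assumes "\<phi> \<in> carrier f_coefficients"
  shows "f_relator \<phi> \<in> relators"
proof -
  have "f_relator ` carrier f_coefficients \<subseteq> relators"
    unfolding relators_def by (intro formal_sums.subset_set_mult subgroup.subset subgroup.one_closed
        group_hom.img_is_subgroup group_hom_f_relator group_hom_g_relator)
  then show ?thesis using assms by blast
qed

lemma g_relator_in_relators:
  assumes "\<tau> \<in> carrier g_coefficients"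
  shows "g_relator \<tau> \<in> relators"
proof -
  have "g_relator ` carrier g_coefficients \<subseteq> relators"
    unfolding relators_def by (intro formal_sums.subset_set_mult subgroup.subset subgroup.one_closed
        group_hom.img_is_subgroup group_hom_f_relator group_hom_g_relator)
  then show ?thesis using assms by blast
qed

lemma finprod_f_eq_finprod_g:
  assumes \<phi>: "\<phi> \<in> carrier f_coefficients" and \<tau>: "\<tau> \<in> carrier g_coefficients"
    and col: "\<And>s. s \<in> carrier Q \<Longrightarrow> gfinprod P (\<lambda>w. \<phi> w [^]\<^bsub>P\<^esub> Poly_Mapping.lookup w s) weights = \<tau> s"
  shows "gfinprod C (\<lambda>w. f (\<phi> w) (weighted_sum w)) weights = gfinprod C (\<lambda>s. g (\<tau> s) s) (carrier Q)"
proof -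
  define I where "I = {w \<in> weights. \<phi> w \<noteq> \<one>\<^bsub>P\<^esub>}"
  define J where "J = (\<Union>w\<in>I. Poly_Mapping.keys w) \<union> {s \<in> carrier Q. \<tau> s \<noteq> \<one>\<^bsub>P\<^esub>}"
  have \<phi>P: "\<phi> w \<in> carrier P" if "w \<in> weights" for w
    using \<phi> that by (auto simp: carrier_sum_group)
  have \<tau>U: "\<tau> s \<in> U" if "s \<in> carrier Q" for s
    using \<tau> that by (auto simp: carrier_sum_group group_U)
  have I: "\<phi> w \<in> carrier P" "weighted_sum w \<in> V" if "w \<in> I" for w
    using \<phi>P that by (auto simp: I_def weights_def)
  have fin: "finite I" "finite J"
    using \<phi> \<tau> by (auto simp: I_def J_def carrier_sum_group group_U)
  have J: "J \<subseteq> carrier Q" by (auto simp: J_def I_def weights_def)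
  have sum_I: "power_product Q (\<lambda>s. s) (Poly_Mapping.lookup w) J = weighted_sum w" if "w \<in> I" for w
    using that fin J by (intro weighted_sum_eq[symmetric]) (auto simp: J_def)
  have col_I: "power_product P \<phi> (\<lambda>w. Poly_Mapping.lookup w s) I = \<tau> s" if "s \<in> carrier Q" for s
    unfolding power_product_def col[OF that, symmetric] using \<phi>P fin(1)
    by (intro P.gfinprod_eq_finprod_support[symmetric]) (auto simp: I_def)
  have "gfinprod C (\<lambda>w. f (\<phi> w) (weighted_sum w)) weights =
      finprod C (\<lambda>w. f (\<phi> w) (weighted_sum w)) I"
    using \<phi>P fin(1) by (intro C.gfinprod_eq_finprod_support) (auto simp: I_def weights_def)
  also have "\<dots> = finprod C (\<lambda>w. f (\<phi> w) (power_product Q (\<lambda>s. s) (Poly_Mapping.lookup w) J)) I"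
    using I by (intro C.finprod_cong') (auto simp: sum_I)
  also have "\<dots> = finprod C (\<lambda>s. g (power_product P \<phi> (\<lambda>w. Poly_Mapping.lookup w s) I) s) J"
    using balanced_all[OF fin] I \<tau>U J by (intro balancedD) (auto simp: sum_I col_I subsetD)
  also have "\<dots> = finprod C (\<lambda>s. g (\<tau> s) s) J"
    using J \<tau>U by (intro C.finprod_cong') (auto simp: col_I subsetD)
  also have "\<dots> = gfinprod C (\<lambda>s. g (\<tau> s) s) (carrier Q)"
    using J fin(2) \<tau>U by (intro C.gfinprod_eq_finprod_support[symmetric]) (auto simp: J_def)
  finally show ?thesis .
qed

lemma relators_Int_C:
  assumes "(\<lambda>s\<in>carrier Q. \<one>\<^bsub>P\<^esub>, c) \<in> relators"
  shows "c = \<one>\<^bsub>C\<^esub>"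
proof -
  interpret f: group_hom f_coefficients formal_sums f_relator by (rule group_hom_f_relator)
  interpret g: group_hom g_coefficients formal_sums g_relator by (rule group_hom_g_relator)
  obtain \<phi> \<tau> where \<phi>: "\<phi> \<in> carrier f_coefficients" and \<tau>: "\<tau> \<in> carrier g_coefficients"
    and eq: "(\<lambda>s\<in>carrier Q. \<one>\<^bsub>P\<^esub>, c) = f_relator \<phi> \<otimes>\<^bsub>formal_sums\<^esub> g_relator \<tau>"
    using assms unfolding relators_def set_mult_def by blast
  define \<tau>' where "\<tau>' = inv\<^bsub>g_coefficients\<^esub> \<tau>"
  have \<tau>': "\<tau>' \<in> carrier g_coefficients" unfolding \<tau>'_def using \<tau> by (rule g.G.inv_closed)
  have c: "c \<in> carrier C"
    using assms subgroup.subset[OF subgroup_relators] by auto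
  have "f_relator \<phi> = (\<lambda>s\<in>carrier Q. \<one>\<^bsub>P\<^esub>, c) \<otimes>\<^bsub>formal_sums\<^esub> g_relator \<tau>'"
    unfolding eq \<tau>'_def g.hom_inv[OF \<tau>]
    using f.hom_closed[OF \<phi>] g.hom_closed[OF \<tau>] by (simp only: formal_sums.m_assoc
        formal_sums.r_inv formal_sums.r_one formal_sums.inv_closed)
  moreover have "\<tau>' s \<in> carrier P" if "s \<in> carrier Q" for s
    using \<tau>' that U.subset by (auto simp: carrier_sum_group group_U)
  ultimately have "gfinprod P (\<lambda>w. \<phi> w [^]\<^bsub>P\<^esub> Poly_Mapping.lookup w s) weights = \<tau>' s"
    if "s \<in> carrier Q" for s
    using that by (auto simp: f_relator_def g_relator_def fun_eq_iff restrict_def split: if_splits)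
  from finprod_f_eq_finprod_g[OF \<phi> \<tau>' this]
  have "inv\<^bsub>C\<^esub> gfinprod C (\<lambda>s. g (\<tau>' s) s) (carrier Q) =
      c \<otimes>\<^bsub>C\<^esub> inv\<^bsub>C\<^esub> gfinprod C (\<lambda>s. g (\<tau>' s) s) (carrier Q)"
    using \<open>f_relator \<phi> = _\<close> by (simp add: f_relator_def g_relator_def)
  moreover have "gfinprod C (\<lambda>s. g (\<tau>' s) s) (carrier Q) \<in> carrier C"
    using \<tau>' by (intro C.gfinprod_closed) (auto simp: carrier_sum_group group_U PiE_iff)
  ultimately show ?thesis using c by simp
qed

definition extension :: "(('y \<Rightarrow> 'x) \<times> 'c) set monoid" where
  "extension = formal_sums Mod relators"

definition coset :: "('y \<Rightarrow> 'x) \<times> 'c \<Rightarrow> (('y \<Rightarrow> 'x) \<times> 'c) set" where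
  "coset h = relators #>\<^bsub>formal_sums\<^esub> h"

definition inclusion :: "'c \<Rightarrow> (('y \<Rightarrow> 'x) \<times> 'c) set" where
  "inclusion c = coset (\<lambda>s\<in>carrier Q. \<one>\<^bsub>P\<^esub>, c)"

definition tensor :: "'x \<Rightarrow> ('y \<Rightarrow>\<^sub>0 int) \<Rightarrow> 'y \<Rightarrow> 'x" where
  "tensor x w = (\<lambda>s\<in>carrier Q. x [^]\<^bsub>P\<^esub> Poly_Mapping.lookup w s)"

definition extended_map :: "'x \<Rightarrow> 'y \<Rightarrow> (('y \<Rightarrow> 'x) \<times> 'c) set" where
  "extended_map x y = coset (tensor x (frag_of y), \<one>\<^bsub>C\<^esub>)"

sublocale extension: comm_group extension
  unfolding extension_def by (rule formal_sums.abelian_FactGroup[OF subgroup_relators])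

lemma normal_relators: "relators \<lhd> formal_sums"
  by (rule formal_sums.subgroup_imp_normal[OF subgroup_relators])

sublocale coset: group_hom formal_sums extension coset
  using normal.group_hom_rcoset[OF normal_relators]
  by (simp add: coset_def[abs_def] extension_def)

lemma tensor_closed [simp]: "x \<in> carrier P \<Longrightarrow> tensor x w \<in> carrier Q \<rightarrow>\<^sub>E carrier P"
  by (simp add: tensor_def)

lemma inclusion_hom: "inclusion \<in> hom C extension"
proof (rule homI)
  show "inclusion (c \<otimes>\<^bsub>C\<^esub> c') = inclusion c \<otimes>\<^bsub>extension\<^esub> inclusion c'"
    if "c \<in> carrier C" "c' \<in> carrier C" for c c'
    using that by (simp add: inclusion_def flip: coset.hom_mult cong: restrict_cong)
qed (simp add: inclusion_def)

lemma inclusion_inj: "inj_on inclusion (carrier C)"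
proof -
  interpret inclusion: group_hom C extension inclusion by unfold_locales (rule inclusion_hom)
  have "c = \<one>\<^bsub>C\<^esub>" if c: "c \<in> carrier C" "inclusion c = \<one>\<^bsub>extension\<^esub>" for c
  proof -
    have "relators #>\<^bsub>formal_sums\<^esub> (\<lambda>s\<in>carrier Q. \<one>\<^bsub>P\<^esub>, c) = relators"
      using c(2) by (simp add: inclusion_def coset_def extension_def)
    then have "(\<lambda>s\<in>carrier Q. \<one>\<^bsub>P\<^esub>, c) \<in> relators"
      using formal_sums.coset_join1[OF _ _ subgroup_relators] c(1)
        subgroup.subset[OF subgroup_relators] by simp
    then show ?thesis by (rule relators_Int_C)
  qed
  then show ?thesis by (intro inclusion.inj_on_one_iff[THEN iffD2]) auto
qed

lemma coset_eq_inclusion: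
  assumes "h \<in> carrier Q \<rightarrow>\<^sub>E carrier P" "c \<in> carrier C" "(h, inv\<^bsub>C\<^esub> c) \<in> relators"
  shows "coset (h, \<one>\<^bsub>C\<^esub>) = inclusion c"
proof -
  have "(h, inv\<^bsub>C\<^esub> c) \<otimes>\<^bsub>formal_sums\<^esub> (\<lambda>s\<in>carrier Q. \<one>\<^bsub>P\<^esub>, c) = (h, \<one>\<^bsub>C\<^esub>)"
    using assms(1,2) by (auto simp: PiE_iff extensional_def)
  then show ?thesis
    using assms(2)
      formal_sums.rcoset_mult_left[OF subgroup_relators assms(3), of "(\<lambda>s\<in>carrier Q. \<one>\<^bsub>P\<^esub>, c)"]
    by (simp add: coset_def inclusion_def)
qed

lemma coset_tensor_weight:
  assumes "x \<in> carrier P" "w \<in> weights"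
  shows "coset (tensor x w, \<one>\<^bsub>C\<^esub>) = inclusion (f x (weighted_sum w))"
proof (rule coset_eq_inclusion)
  show "f x (weighted_sum w) \<in> carrier C" using assms by (simp add: weights_def)
  have "f_relator (delta weights P w x) \<in> relators"
    by (intro f_relator_in_relators delta_in_sum_group P.group_axioms assms(1))
  also have "f_relator (delta weights P w x) = (tensor x w, inv\<^bsub>C\<^esub> f x (weighted_sum w))"
  proof -
    have "gfinprod P (\<lambda>v. delta weights P w x v [^]\<^bsub>P\<^esub> Poly_Mapping.lookup v s) weights =
        x [^]\<^bsub>P\<^esub> Poly_Mapping.lookup w s" for s
      using assms
      by (intro P.gfinprod_delta[where h = "\<lambda>v x. x [^]\<^bsub>P\<^esub> Poly_Mapping.lookup v s"]) auto
    moreover have "gfinprod C (\<lambda>v. f (delta weights P w x v) (weighted_sum v)) weights =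
        f x (weighted_sum w)"
      using assms by (intro C.gfinprod_delta[where h = "\<lambda>v x. f x (weighted_sum v)"])
        (auto simp: weights_def)
    ultimately show ?thesis by (simp add: f_relator_def tensor_def)
  qed
  finally show "(tensor x w, inv\<^bsub>C\<^esub> f x (weighted_sum w)) \<in> relators" .
qed (simp add: assms)

lemma extended_map_f:
  assumes "x \<in> carrier P" "v \<in> V"
  shows "extended_map x v = inclusion (f x v)"
  unfolding extended_map_def using assms
  by (subst coset_tensor_weight) (auto simp: weights_def weighted_sum_frag_of)

lemma extended_map_g:
  assumes "u \<in> U" "y \<in> carrier Q"
  shows "extended_map u y = inclusion (g u y)"
  unfolding extended_map_def
proof (rule coset_eq_inclusion)
  show "tensor u (frag_of y) \<in> carrier Q \<rightarrow>\<^sub>E carrier P" using assms by simp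
  show "g u y \<in> carrier C" using assms by simp
  have "g_relator (delta (carrier Q) (P\<lparr>carrier := U\<rparr>) y u) \<in> relators"
    using assms by (intro g_relator_in_relators delta_in_sum_group group_U) simp
  also have "g_relator (delta (carrier Q) (P\<lparr>carrier := U\<rparr>) y u) =
      (delta (carrier Q) (P\<lparr>carrier := U\<rparr>) y u, inv\<^bsub>C\<^esub> g u y)"
    unfolding g_relator_def using assms
    by (subst C.gfinprod_delta[where h = "\<lambda>s u. g u s"]) auto
  also have "delta (carrier Q) (P\<lparr>carrier := U\<rparr>) y u = tensor u (frag_of y)"
    using assms by (auto simp: delta_def tensor_def)
  finally show "(tensor u (frag_of y), inv\<^bsub>C\<^esub> g u y) \<in> relators" .
qed

lemma coset_tensor_add:
  assumes "x \<in> carrier P"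
  shows "coset (tensor x (v + w), \<one>\<^bsub>C\<^esub>) =
    coset (tensor x v, \<one>\<^bsub>C\<^esub>) \<otimes>\<^bsub>extension\<^esub> coset (tensor x w, \<one>\<^bsub>C\<^esub>)"
  using assms
  by (simp add: tensor_def lookup_add P.int_pow_mult flip: coset.hom_mult cong: restrict_cong)

lemma bilinear_map_extended_map:
  "bilinear_map P Q extension (carrier P) (carrier Q) extended_map"
proof (intro bilinear_map.intro bilinear_map_axioms.intro P.group_axioms Q.group_axioms
    P.subgroup_self Q.subgroup_self extension.comm_group_axioms)
  show "extended_map x y \<in> carrier extension" if "x \<in> carrier P" for x y
    using that by (simp add: extended_map_def)
  show "extended_map (x \<otimes>\<^bsub>P\<^esub> x') y = extended_map x y \<otimes>\<^bsub>extension\<^esub> extended_map x' y"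
    if "x \<in> carrier P" "x' \<in> carrier P" for x x' y
    using that
    by (simp add: extended_map_def tensor_def P.int_pow_distrib
        flip: coset.hom_mult cong: restrict_cong)
  show "extended_map x (y \<otimes>\<^bsub>Q\<^esub> y') = extended_map x y \<otimes>\<^bsub>extension\<^esub> extended_map x y'"
    if x: "x \<in> carrier P" and y: "y \<in> carrier Q" "y' \<in> carrier Q" for x y y'
  proof -
    define r where "r = frag_of (y \<otimes>\<^bsub>Q\<^esub> y') - (frag_of y + frag_of y')"
    have keys: "Poly_Mapping.keys r \<subseteq> carrier Q"
      "Poly_Mapping.keys (frag_of y + frag_of y') \<subseteq> carrier Q"
      using y keys_add[of "frag_of y" "frag_of y'"]
        keys_diff[of "frag_of (y \<otimes>\<^bsub>Q\<^esub> y')" "frag_of y + frag_of y'"] by (auto simp: r_def)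
    have sum: "frag_of (y \<otimes>\<^bsub>Q\<^esub> y') = r + (frag_of y + frag_of y')" by (simp add: r_def)
    have "weighted_sum r \<in> carrier Q"
      unfolding weighted_sum_def using keys(1) by (intro Q.power_product_closed) auto
    moreover have "y \<otimes>\<^bsub>Q\<^esub> y' = weighted_sum r \<otimes>\<^bsub>Q\<^esub> (y \<otimes>\<^bsub>Q\<^esub> y')"
      using y keys weighted_sum_add[of r "frag_of y + frag_of y'"]
        weighted_sum_frag_of[of "y \<otimes>\<^bsub>Q\<^esub> y'"]
      by (simp add: weighted_sum_add weighted_sum_frag_of flip: sum)
    ultimately have sum_r: "weighted_sum r = \<one>\<^bsub>Q\<^esub>" using y by simp
    then have "coset (tensor x r, \<one>\<^bsub>C\<^esub>) = inclusion \<one>\<^bsub>C\<^esub>"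
      using x keys(1) coset_tensor_weight[of x r] by (simp add: weights_def)
    also have "\<dots> = \<one>\<^bsub>extension\<^esub>"
      using coset.hom_one by (simp add: inclusion_def)
    finally show ?thesis
      using x by (simp add: extended_map_def sum coset_tensor_add)
  qed
qed

lemma extension_exponent:
  assumes exponent_C: "\<And>c. c \<in> carrier C \<Longrightarrow> c [^]\<^bsub>C\<^esub> n = \<one>\<^bsub>C\<^esub>" and "e \<in> carrier extension"
  shows "e [^]\<^bsub>extension\<^esub> n = \<one>\<^bsub>extension\<^esub>"
  unfolding extension_def
proof (rule normal.FactGroup_exponent[OF normal_relators])
  fix z assume "z \<in> carrier formal_sums"
  then show "z [^]\<^bsub>formal_sums\<^esub> n = \<one>\<^bsub>formal_sums\<^esub>"
    by (auto simp: formal_sums_def nat_pow_DirProd nat_pow_product_group exponent_P exponent_C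
        PiE_iff intro!: restrict_ext)
qed (use assms(2) in \<open>simp add: extension_def\<close>)

end

section \<open>Groups in the variety \<open>(m, n)\<close>\<close>

abbreviation commutator_group :: "('a, 'r) monoid_scheme \<Rightarrow> ('a, 'r) monoid_scheme" where
  "commutator_group G \<equiv> G\<lparr>carrier := commutator_subgroup G\<rparr>"

definition verbal_subgroup :: "nat \<Rightarrow> ('a, 'r) monoid_scheme \<Rightarrow> 'a set" where
  "verbal_subgroup n G = power_subgroup G n <#>\<^bsub>G\<^esub> commutator_subgroup G"

context group
begin

lemma commutator_closed [simp, intro]:
  "x \<in> carrier G \<Longrightarrow> y \<in> carrier G \<Longrightarrow> commutator G x y \<in> carrier G"
  by (simp add: commutator_def)

lemma mult_commutator:
  assumes "x \<in> carrier G" "y \<in> carrier G"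
  shows "y \<otimes> x \<otimes> commutator G x y = x \<otimes> y"
proof -
  have "commutator G x y = inv (y \<otimes> x) \<otimes> (x \<otimes> y)"
    using assms by (simp add: commutator_def inv_mult_group m_assoc)
  then show ?thesis using assms by (simp add: m_assoc[symmetric])
qed

lemma commutator_eqI:
  assumes "x \<in> carrier G" "y \<in> carrier G" "z \<in> carrier G" "y \<otimes> x \<otimes> z = x \<otimes> y"
  shows "commutator G x y = z"
  using assms mult_commutator[of x y] by (metis commutator_closed l_cancel m_closed)

lemma commutator_eq_one_iff:
  assumes "x \<in> carrier G" "y \<in> carrier G"
  shows "commutator G x y = \<one> \<longleftrightarrow> x \<otimes> y = y \<otimes> x"
  using assms mult_commutator[of x y] commutator_eqI[of x y \<one>] by auto

lemma inv_commutator: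
  assumes "x \<in> carrier G" "y \<in> carrier G"
  shows "inv (commutator G x y) = commutator G y x"
  using assms by (simp add: commutator_def inv_mult_group m_assoc)

lemma center_iff_commutator:
  "z \<in> center G \<longleftrightarrow> z \<in> carrier G \<and> (\<forall>x\<in>carrier G. commutator G z x = \<one>)"
  by (auto simp: center_def commutator_eq_one_iff)

lemma center_closed: "z \<in> center G \<Longrightarrow> z \<in> carrier G"
  by (simp add: center_def)

lemma center_commutes: "z \<in> center G \<Longrightarrow> x \<in> carrier G \<Longrightarrow> z \<otimes> x = x \<otimes> z"
  by (simp add: center_def)

lemma centerI:
  "z \<in> carrier G \<Longrightarrow> (\<And>x. x \<in> carrier G \<Longrightarrow> z \<otimes> x = x \<otimes> z) \<Longrightarrow> z \<in> center G"
  by (simp add: center_def)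

lemma subgroup_center: "subgroup (center G) G"
proof (rule subgroupI)
  have "\<one> \<in> center G" by (intro centerI) simp_all
  then show "center G \<noteq> {}" by blast
next
  fix z assume z: "z \<in> center G"
  have "inv z \<otimes> x = x \<otimes> inv z" if x: "x \<in> carrier G" for x
  proof -
    have "z \<otimes> inv x = inv x \<otimes> z" using z x by (intro center_commutes) auto
    then have "inv (z \<otimes> inv x) = inv (inv x \<otimes> z)" by simp
    then show ?thesis using z x by (simp add: inv_mult_group center_closed)
  qed
  with z show "inv z \<in> center G" by (intro centerI) (simp_all add: center_closed)
next
  fix z z' assume z: "z \<in> center G" "z' \<in> center G"
  have "z \<otimes> z' \<otimes> x = x \<otimes> (z \<otimes> z')" if x: "x \<in> carrier G" for x
  proof -
    have "z \<otimes> z' \<otimes> x = z \<otimes> x \<otimes> z'"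
      using z x by (simp add: m_assoc center_closed center_commutes[of z' x])
    also have "\<dots> = x \<otimes> (z \<otimes> z')"
      using z x by (simp add: m_assoc center_closed center_commutes[of z x])
    finally show ?thesis .
  qed
  with z show "z \<otimes> z' \<in> center G" by (intro centerI) (simp_all add: center_closed)
next
  show "center G \<subseteq> carrier G" by (auto simp: center_closed)
qed

lemma normal_if_central:
  assumes "subgroup S G" "S \<subseteq> center G"
  shows "S \<lhd> G"
  unfolding normal_inv_iff
proof (intro conjI ballI)
  fix x h assume x: "x \<in> carrier G" and h: "h \<in> S"
  then have "h \<in> center G" using assms(2) by blast
  then have "x \<otimes> h = h \<otimes> x" "h \<in> carrier G"
    using x center_commutes[of h x] by (simp_all add: center_closed)
  then have "x \<otimes> h \<otimes> inv x = h" using x by (simp add: m_assoc)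
  then show "x \<otimes> h \<otimes> inv x \<in> S" using h by simp
qed fact

lemma subgroup_power_subgroup: "subgroup (power_subgroup G n) G"
  unfolding power_subgroup_def using triv_subgroup by (auto intro: generate_is_subgroup)

lemma subgroup_commutator_subgroup: "subgroup (commutator_subgroup G) G"
  by (rule derived_is_subgroup) simp

lemma commutator_subgroup_closed: "x \<in> commutator_subgroup G \<Longrightarrow> x \<in> carrier G"
  using subgroup.mem_carrier[OF subgroup_commutator_subgroup] .

lemma commutator_in_commutator_subgroup:
  "x \<in> carrier G \<Longrightarrow> y \<in> carrier G \<Longrightarrow> commutator G x y \<in> commutator_subgroup G"
  unfolding commutator_subgroup_eq by (auto intro: generate.incl)

lemma commutator_subgroup_subset:
  assumes "subgroup S G" "\<And>x y. x \<in> carrier G \<Longrightarrow> y \<in> carrier G \<Longrightarrow> commutator G x y \<in> S"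
  shows "commutator_subgroup G \<subseteq> S"
  unfolding commutator_subgroup_eq using assms by (intro generate_subgroup_incl) auto

lemma subgroup_verbal_subgroup: "subgroup (verbal_subgroup n G) G"
  unfolding verbal_subgroup_def
  using mult_norm_subgroup[OF derived_self_is_normal subgroup_power_subgroup]
    commut_normal[OF subgroup_power_subgroup derived_self_is_normal] by simp

lemma commutator_subgroup_subset_verbal_subgroup: "commutator_subgroup G \<subseteq> verbal_subgroup n G"
  and power_subgroup_subset_verbal_subgroup: "power_subgroup G n \<subseteq> verbal_subgroup n G"
  unfolding verbal_subgroup_def
  by (intro subset_set_mult subgroup.subset subgroup.one_closed subgroup_power_subgroup
      subgroup_commutator_subgroup)+

lemma commutator_in_verbal_subgroup:
  "x \<in> carrier G \<Longrightarrow> y \<in> carrier G \<Longrightarrow> commutator G x y \<in> verbal_subgroup n G"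
  using commutator_in_commutator_subgroup commutator_subgroup_subset_verbal_subgroup by blast

lemma pow_in_verbal_subgroup:
  assumes "x \<in> carrier G"
  shows "x [^] n \<in> verbal_subgroup n G"
proof -
  have "x [^] n \<in> power_subgroup G n"
    using assms by (auto simp: power_subgroup_def intro: generate.incl)
  then show ?thesis using power_subgroup_subset_verbal_subgroup by blast
qed

lemma verbal_subgroup_subset:
  assumes S: "subgroup S G" and pow: "\<And>x. x \<in> carrier G \<Longrightarrow> x [^] n \<in> S"
    and comm: "\<And>x y. x \<in> carrier G \<Longrightarrow> y \<in> carrier G \<Longrightarrow> commutator G x y \<in> S"
  shows "verbal_subgroup n G \<subseteq> S"
proof -
  have "generate G {x [^] n | x. x \<in> carrier G} \<subseteq> S"
    using pow by (intro generate_subgroup_incl S) auto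
  then have "power_subgroup G n \<subseteq> S"
    using subgroup.one_closed[OF S] by (simp add: power_subgroup_def)
  moreover have "commutator_subgroup G \<subseteq> S" using S comm by (rule commutator_subgroup_subset)
  ultimately show ?thesis
    using S by (auto simp: verbal_subgroup_def set_mult_def intro!: subgroup.m_closed[OF S])
qed

end

lemma (in group_hom) hom_commutator:
  "x \<in> carrier G \<Longrightarrow> y \<in> carrier G \<Longrightarrow> h (commutator G x y) = commutator H (h x) (h y)"
  by (simp add: commutator_def)

lemma (in group_hom) hom_verbal_subgroup:
  assumes "x \<in> verbal_subgroup n G"
  shows "h x \<in> verbal_subgroup n H"
proof -
  note verbal = H.subgroup_verbal_subgroup[of n]
  have "subgroup {x \<in> carrier G. h x \<in> verbal_subgroup n H} G"
  proof (rule G.subgroupI)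
    have "\<one>\<^bsub>G\<^esub> \<in> {x \<in> carrier G. h x \<in> verbal_subgroup n H}"
      using subgroup.one_closed[OF verbal] by simp
    then show "{x \<in> carrier G. h x \<in> verbal_subgroup n H} \<noteq> {}" by blast
  qed (auto simp: subgroup.m_inv_closed[OF verbal] subgroup.m_closed[OF verbal])
  then have "verbal_subgroup n G \<subseteq> {x \<in> carrier G. h x \<in> verbal_subgroup n H}"
    by (rule G.verbal_subgroup_subset)
      (auto simp: hom_nat_pow hom_commutator
        H.pow_in_verbal_subgroup H.commutator_in_verbal_subgroup)
  then show ?thesis using assms by blast
qed

locale variety_group = group G for G (structure) and m n :: nat +
  assumes in_variety: "in_variety m n G"
begin

lemma pow_m: "x \<in> carrier G \<Longrightarrow> x [^] m = \<one>"
  using in_variety by (simp add: in_variety_def)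

lemma commutator_pow_n: "x \<in> carrier G \<Longrightarrow> y \<in> carrier G \<Longrightarrow> commutator G x y [^] n = \<one>"
  using in_variety by (simp add: in_variety_def)

lemma commutator_in_center: "x \<in> carrier G \<Longrightarrow> y \<in> carrier G \<Longrightarrow> commutator G x y \<in> center G"
  using in_variety by (simp add: in_variety_def center_iff_commutator)

lemma commutator_subgroup_subset_center: "commutator_subgroup G \<subseteq> center G"
  by (intro commutator_subgroup_subset subgroup_center commutator_in_center)

lemma comm_group_commutator_subgroup: "comm_group (commutator_group G)"
proof -
  interpret S: group "commutator_group G"
    using subgroup.subgroup_is_group[OF subgroup_commutator_subgroup group_axioms] .
  show ?thesis
    using commutator_subgroup_subset_center
    by (intro S.group_comm_groupI) (auto intro!: center_commutes center_closed)
qed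

lemma commutator_mult_left:
  assumes "x \<in> carrier G" "y \<in> carrier G" "z \<in> carrier G"
  shows "commutator G (x \<otimes> y) z = commutator G x z \<otimes> commutator G y z"
proof (rule commutator_eqI)
  have "z \<otimes> (x \<otimes> y) \<otimes> (commutator G x z \<otimes> commutator G y z)
    = z \<otimes> x \<otimes> (y \<otimes> commutator G x z) \<otimes> commutator G y z" using assms by (simp add: m_assoc)
  also have "y \<otimes> commutator G x z = commutator G x z \<otimes> y"
    using assms by (simp add: center_commutes commutator_in_center)
  also have "z \<otimes> x \<otimes> (commutator G x z \<otimes> y) \<otimes> commutator G y z
    = (z \<otimes> x \<otimes> commutator G x z) \<otimes> y \<otimes> commutator G y z"
    using assms by (simp add: m_assoc)
  also have "\<dots> = x \<otimes> (z \<otimes> y \<otimes> commutator G y z)"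
    using assms by (subst mult_commutator) (auto simp: m_assoc)
  also have "\<dots> = x \<otimes> y \<otimes> z"
    using assms by (subst mult_commutator) (auto simp: m_assoc)
  finally show "z \<otimes> (x \<otimes> y) \<otimes> (commutator G x z \<otimes> commutator G y z) = x \<otimes> y \<otimes> z" .
qed (use assms in auto)

lemma commutator_mult_right:
  assumes "x \<in> carrier G" "y \<in> carrier G" "z \<in> carrier G"
  shows "commutator G x (y \<otimes> z) = commutator G x y \<otimes> commutator G x z"
proof -
  have "commutator G x (y \<otimes> z) = inv (commutator G y x \<otimes> commutator G z x)"
    using assms by (simp add: inv_commutator flip: commutator_mult_left)
  also have "\<dots> = commutator G x z \<otimes> commutator G x y"
    using assms by (simp add: inv_mult_group inv_commutator)
  finally show ?thesis using assms by (simp add: center_commutes commutator_in_center)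
qed

sublocale commutator: bilinear_map G G "commutator_group G" "carrier G" "carrier G" "commutator G"
  by (intro bilinear_map.intro bilinear_map_axioms.intro group_axioms subgroup_self
      comm_group_commutator_subgroup)
    (simp_all add: commutator_in_commutator_subgroup commutator_mult_left commutator_mult_right)

lemma commutator_inv_left:
  "x \<in> carrier G \<Longrightarrow> y \<in> carrier G \<Longrightarrow> commutator G (inv x) y = inv (commutator G x y)"
  using commutator.inv_left
  by (simp add: m_inv_consistent[OF subgroup_commutator_subgroup] commutator_in_commutator_subgroup)

lemma commutator_center_right: "z \<in> center G \<Longrightarrow> x \<in> carrier G \<Longrightarrow> commutator G x z = \<one>"
  by (simp add: commutator_eq_one_iff center_closed center_commutes)

lemma commutator_pow_mult_center:
  assumes "x \<in> carrier G" "y \<in> carrier G" "z \<in> center G" "z' \<in> center G"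
  shows "commutator G (x [^] (q :: nat) \<otimes> z) y = commutator G x (y [^] q \<otimes> z')"
  using assms commutator.nat_pow_left[of x y q] commutator.nat_pow_right[of y x q]
  by (simp add: commutator_mult_left commutator_mult_right commutator_center_right center_closed
      center_iff_commutator[THEN iffD1])

lemma commutator_subgroup_pow_n:
  assumes "x \<in> commutator_subgroup G"
  shows "x [^] n = \<one>"
proof -
  have "subgroup {x \<in> center G. x [^] n = \<one>} G"
  proof (rule subgroupI)
    have "\<one> \<in> {x \<in> center G. x [^] n = \<one>}" using subgroup.one_closed[OF subgroup_center] by simp
    then show "{x \<in> center G. x [^] n = \<one>} \<noteq> {}" by blast
  qed (auto simp: subgroup.m_inv_closed[OF subgroup_center] subgroup.m_closed[OF subgroup_center]
      nat_pow_inv pow_mult_distrib center_commutes center_closed)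
  then have "commutator_subgroup G \<subseteq> {x \<in> center G. x [^] n = \<one>}"
    by (rule commutator_subgroup_subset) (simp add: commutator_in_center commutator_pow_n)
  then show ?thesis using assms by blast
qed

lemma verbal_subgroup_subset_center: "verbal_subgroup n G \<subseteq> center G"
proof (intro verbal_subgroup_subset subgroup_center commutator_in_center)
  fix x assume "x \<in> carrier G"
  then show "x [^] n \<in> center G"
    using commutator.nat_pow_left
    by (simp add: center_iff_commutator commutator_pow_n flip: nat_pow_consistent)
qed

lemma normal_verbal_subgroup: "verbal_subgroup n G \<lhd> G"
  by (rule normal_if_central[OF subgroup_verbal_subgroup verbal_subgroup_subset_center])

abbreviation verbal_quotient :: "'a set monoid" where
  "verbal_quotient \<equiv> G Mod verbal_subgroup n G"

abbreviation verbal_coset :: "'a \<Rightarrow> 'a set" where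
  "verbal_coset x \<equiv> verbal_subgroup n G #> x"

sublocale verbal_coset: group_hom G verbal_quotient verbal_coset
  by (rule normal.group_hom_rcoset[OF normal_verbal_subgroup])

lemma verbal_coset_eq_one_iff:
  "x \<in> carrier G \<Longrightarrow> verbal_coset x = \<one>\<^bsub>verbal_quotient\<^esub> \<longleftrightarrow> x \<in> verbal_subgroup n G"
  using rcos_self[of x "verbal_subgroup n G"] coset_join2[of x "verbal_subgroup n G"]
  by (auto simp: subgroup_verbal_subgroup)

lemma comm_group_verbal_quotient: "comm_group verbal_quotient"
proof (rule verbal_coset.H.group_comm_groupI)
  fix \<xi> \<eta> assume "\<xi> \<in> carrier verbal_quotient" "\<eta> \<in> carrier verbal_quotient"
  then obtain x y where xy: "x \<in> carrier G" "\<xi> = verbal_coset x"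
    "y \<in> carrier G" "\<eta> = verbal_coset y"
    by (auto simp: carrier_FactGroup)
  then have "commutator verbal_quotient \<xi> \<eta> = verbal_coset (commutator G x y)"
    by (simp add: verbal_coset.hom_commutator)
  also have "\<dots> = \<one>\<^bsub>verbal_quotient\<^esub>"
    using xy by (simp only: verbal_coset_eq_one_iff commutator_closed commutator_in_verbal_subgroup)
  finally show "\<xi> \<otimes>\<^bsub>verbal_quotient\<^esub> \<eta> = \<eta> \<otimes>\<^bsub>verbal_quotient\<^esub> \<xi>"
    using xy verbal_coset.hom_closed verbal_coset.H.commutator_eq_one_iff by blast
qed

lemma verbal_quotient_exponent:
  assumes "\<xi> \<in> carrier verbal_quotient"
  shows "\<xi> [^]\<^bsub>verbal_quotient\<^esub> n = \<one>\<^bsub>verbal_quotient\<^esub>"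
proof -
  obtain x where x: "x \<in> carrier G" "\<xi> = verbal_coset x"
    using assms by (auto simp: carrier_FactGroup)
  then have "\<xi> [^]\<^bsub>verbal_quotient\<^esub> n = verbal_coset (x [^] n)"
    by (simp add: verbal_coset.hom_nat_pow)
  also have "\<dots> = \<one>\<^bsub>verbal_quotient\<^esub>"
    using x by (simp only: verbal_coset_eq_one_iff nat_pow_closed pow_in_verbal_subgroup)
  finally show ?thesis .
qed

end

lemma variety_groupI: "in_variety m n G \<Longrightarrow> variety_group G m n"
  by (simp add: variety_group_def variety_group_axioms_def in_variety_def)

lemma in_variety_surj_hom:
  assumes M: "in_variety m n M" and h: "group_hom M N h" and surj: "h ` carrier M = carrier N"
  shows "in_variety m n N"
proof -
  interpret h: group_hom M N h by (rule h)
  have identities: "x [^]\<^bsub>M\<^esub> m = \<one>\<^bsub>M\<^esub>" "commutator M x y [^]\<^bsub>M\<^esub> n = \<one>\<^bsub>M\<^esub>"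
    "commutator M (commutator M x y) z = \<one>\<^bsub>M\<^esub>"
    if "x \<in> carrier M" "y \<in> carrier M" "z \<in> carrier M" for x y z
    using that M by (auto simp: in_variety_def)
  have "h x [^]\<^bsub>N\<^esub> m = \<one>\<^bsub>N\<^esub>" if "x \<in> carrier M" for x
    using that identities(1)[of x x x] by (simp flip: h.hom_nat_pow)
  moreover have "commutator N (h x) (h y) [^]\<^bsub>N\<^esub> n = \<one>\<^bsub>N\<^esub>"
    if "x \<in> carrier M" "y \<in> carrier M" for x y
    using that identities(2)[of x y x] by (simp flip: h.hom_commutator h.hom_nat_pow)
  moreover have "commutator N (commutator N (h x) (h y)) (h z) = \<one>\<^bsub>N\<^esub>"
    if "x \<in> carrier M" "y \<in> carrier M" "z \<in> carrier M" for x y z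
    using that identities(3)[of x y z] by (simp flip: h.hom_commutator)
  ultimately show ?thesis
    unfolding in_variety_def using h.H.group_axioms by (simp flip: surj)
qed

section \<open>Twisted products\<close>

lemma dvd_choose_two:
  fixes m n :: nat
  assumes "n dvd m div gcd 2 m"
  shows "n dvd m" "n dvd m choose 2"
proof -
  have "m div gcd 2 m dvd m" by (metis dvd_def dvd_mult_div_cancel gcd_dvd2 mult.commute)
  with assms show "n dvd m" by (rule dvd_trans)
  show "n dvd m choose 2"
  proof (cases "even m")
    case True
    then obtain j where j: "m = 2 * j" by blast
    then have "n dvd j" using assms by simp
    moreover have "m choose 2 = j * (m - 1)" using j by (simp add: choose_two)
    ultimately show ?thesis by simp
  next
    case False
    then have "even (m - 1)" by simp
    then obtain j where j: "m - 1 = 2 * j" by blast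
    have "m choose 2 = m * j" unfolding choose_two j by simp
    with \<open>n dvd m\<close> show ?thesis by simp
  qed
qed

lemma (in monoid) nat_pow_dvd:
  assumes "x \<in> carrier G" "x [^] (n :: nat) = \<one>" "n dvd k"
  shows "x [^] k = \<one>"
proof -
  obtain j where "k = n * j" using assms(3) by blast
  then show ?thesis using assms by (simp flip: nat_pow_pow)
qed

locale twisted_product =
  A: variety_group A m n + B: variety_group B m n + E: comm_group E +
  c: bilinear_map A B E "carrier A" "carrier B" c
  for A :: "('a, 'r) monoid_scheme" and B :: "('b, 's) monoid_scheme"
    and E :: "('e, 't) monoid_scheme" and m n and c +
  assumes dvd: "n dvd m div gcd 2 m"
    and exponent_E: "e \<in> carrier E \<Longrightarrow> e [^]\<^bsub>E\<^esub> n = \<one>\<^bsub>E\<^esub>"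
begin

text \<open>The cocycle is chosen such that \<open>[a, b] = c a b\<close>.\<close>

definition twisted :: "('a \<times> 'b \<times> 'e) monoid" where
  "twisted = \<lparr>carrier = carrier A \<times> carrier B \<times> carrier E,
     monoid.mult = (\<lambda>(a, b, e) (a', b', e'). (a \<otimes>\<^bsub>A\<^esub> a', b \<otimes>\<^bsub>B\<^esub> b', e \<otimes>\<^bsub>E\<^esub> e' \<otimes>\<^bsub>E\<^esub> inv\<^bsub>E\<^esub> c a' b)),
     one = (\<one>\<^bsub>A\<^esub>, \<one>\<^bsub>B\<^esub>, \<one>\<^bsub>E\<^esub>)\<rparr>"

lemma twisted_simps [simp]:
  "carrier twisted = carrier A \<times> carrier B \<times> carrier E"
  "\<one>\<^bsub>twisted\<^esub> = (\<one>\<^bsub>A\<^esub>, \<one>\<^bsub>B\<^esub>, \<one>\<^bsub>E\<^esub>)"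
  "(a, b, e) \<otimes>\<^bsub>twisted\<^esub> (a', b', e') = (a \<otimes>\<^bsub>A\<^esub> a', b \<otimes>\<^bsub>B\<^esub> b', e \<otimes>\<^bsub>E\<^esub> e' \<otimes>\<^bsub>E\<^esub> inv\<^bsub>E\<^esub> c a' b)"
  by (simp_all add: twisted_def)

sublocale twisted: group twisted
proof (rule groupI)
  fix x y z assume "x \<in> carrier twisted" "y \<in> carrier twisted" "z \<in> carrier twisted"
  then obtain a b e a' b' e' a'' b'' e''
    where "x = (a, b, e)" "y = (a', b', e')" "z = (a'', b'', e'')"
      "a \<in> carrier A" "b \<in> carrier B" "e \<in> carrier E"
      "a' \<in> carrier A" "b' \<in> carrier B" "e' \<in> carrier E"
      "a'' \<in> carrier A" "b'' \<in> carrier B" "e'' \<in> carrier E"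
    by auto
  then show "x \<otimes>\<^bsub>twisted\<^esub> y \<otimes>\<^bsub>twisted\<^esub> z = x \<otimes>\<^bsub>twisted\<^esub> (y \<otimes>\<^bsub>twisted\<^esub> z)"
    by (simp add: A.m_assoc B.m_assoc c.mult_left c.mult_right E.inv_mult E.m_ac)
next
  fix x assume "x \<in> carrier twisted"
  then obtain a b e where x: "x = (a, b, e)" "a \<in> carrier A" "b \<in> carrier B" "e \<in> carrier E" by auto
  let ?y = "(inv\<^bsub>A\<^esub> a, inv\<^bsub>B\<^esub> b, inv\<^bsub>E\<^esub> e \<otimes>\<^bsub>E\<^esub> inv\<^bsub>E\<^esub> c a b)"
  have "?y \<otimes>\<^bsub>twisted\<^esub> x = \<one>\<^bsub>twisted\<^esub>" "?y \<in> carrier twisted"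
    using x by (simp_all add: c.inv_right E.m_ac)
  then show "\<exists>y\<in>carrier twisted. y \<otimes>\<^bsub>twisted\<^esub> x = \<one>\<^bsub>twisted\<^esub>" by blast
qed auto

lemma twisted_pow:
  assumes "a \<in> carrier A" "b \<in> carrier B" "e \<in> carrier E"
  shows "(a, b, e) [^]\<^bsub>twisted\<^esub> (k :: nat) =
    (a [^]\<^bsub>A\<^esub> k, b [^]\<^bsub>B\<^esub> k, e [^]\<^bsub>E\<^esub> k \<otimes>\<^bsub>E\<^esub> inv\<^bsub>E\<^esub> (c a b [^]\<^bsub>E\<^esub> (k choose 2)))"
proof (induction k)
  case (Suc k)
  have "Suc k choose 2 = k + (k choose 2)" by (simp add: numeral_2_eq_2)
  with Suc assms show ?case
    by (simp add: c.nat_pow_right E.inv_mult E.m_ac flip: E.nat_pow_mult)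
qed (simp add: binomial_eq_0)

lemma twisted_commutator:
  assumes "a \<in> carrier A" "b \<in> carrier B" "e \<in> carrier E"
    and "a' \<in> carrier A" "b' \<in> carrier B" "e' \<in> carrier E"
  shows "commutator twisted (a, b, e) (a', b', e') =
    (commutator A a a', commutator B b b', c a b' \<otimes>\<^bsub>E\<^esub> inv\<^bsub>E\<^esub> c a' b)"
proof (rule twisted.commutator_eqI)
  have "inv\<^bsub>E\<^esub> c a b' \<otimes>\<^bsub>E\<^esub> (c a b' \<otimes>\<^bsub>E\<^esub> inv\<^bsub>E\<^esub> c a' b) = inv\<^bsub>E\<^esub> c a' b"
    using assms by (simp flip: E.m_assoc)
  then have "e' \<otimes>\<^bsub>E\<^esub> e \<otimes>\<^bsub>E\<^esub> inv\<^bsub>E\<^esub> c a b' \<otimes>\<^bsub>E\<^esub> (c a b' \<otimes>\<^bsub>E\<^esub> inv\<^bsub>E\<^esub> c a' b) =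
      e \<otimes>\<^bsub>E\<^esub> e' \<otimes>\<^bsub>E\<^esub> inv\<^bsub>E\<^esub> c a' b"
    using assms E.m_comm[of e' e] by (simp add: E.m_assoc)
  then show "(a', b', e') \<otimes>\<^bsub>twisted\<^esub> (a, b, e) \<otimes>\<^bsub>twisted\<^esub>
      (commutator A a a', commutator B b b', c a b' \<otimes>\<^bsub>E\<^esub> inv\<^bsub>E\<^esub> c a' b) =
    (a, b, e) \<otimes>\<^bsub>twisted\<^esub> (a', b', e')"
    using assms
    by (simp add: A.mult_commutator B.mult_commutator A.commutator_in_commutator_subgroup)
qed (use assms in auto)

lemma in_variety_twisted: "in_variety m n twisted"
  unfolding in_variety_def
proof (intro conjI ballI)
  have E_pow: "e [^]\<^bsub>E\<^esub> k = \<one>\<^bsub>E\<^esub>" if "e \<in> carrier E" "n dvd k" for e k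
    using E.nat_pow_dvd that exponent_E by blast
  show "group twisted" by (rule twisted.group_axioms)
  show "x [^]\<^bsub>twisted\<^esub> m = \<one>\<^bsub>twisted\<^esub>" if "x \<in> carrier twisted" for x
    using that dvd_choose_two[OF dvd] by (auto simp: twisted_pow E_pow A.pow_m B.pow_m)
  show "commutator twisted x y [^]\<^bsub>twisted\<^esub> n = \<one>\<^bsub>twisted\<^esub>"
    if "x \<in> carrier twisted" "y \<in> carrier twisted" for x y
    using that
    by (auto simp: twisted_commutator twisted_pow E_pow A.commutator_in_commutator_subgroup
        A.commutator_pow_n B.commutator_pow_n)
  show "commutator twisted (commutator twisted x y) z = \<one>\<^bsub>twisted\<^esub>"
    if "x \<in> carrier twisted" "y \<in> carrier twisted" "z \<in> carrier twisted" for x y z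
    using that
    by (auto simp: twisted_commutator A.commutator_in_commutator_subgroup
        B.commutator_in_commutator_subgroup
        A.center_iff_commutator[THEN iffD1, OF A.commutator_in_center]
        B.center_iff_commutator[THEN iffD1, OF B.commutator_in_center])
qed

end

locale twisted_amalgam = twisted_product A B E m n c +
  \<alpha>: group_hom D A \<alpha> + \<beta>: group_hom D B \<beta> +
  \<sigma>: group_hom "commutator_group A" E \<sigma> +
  \<tau>: group_hom "commutator_group B" E \<tau>
  for A :: "('a, 'r) monoid_scheme" and B :: "('b, 's) monoid_scheme"
    and E :: "('e, 't) monoid_scheme" and m n c
    and D :: "('d, 'u) monoid_scheme" and \<alpha> \<beta> \<sigma> \<tau> +
  assumes c_\<beta>: "a \<in> carrier A \<Longrightarrow> d \<in> carrier D \<Longrightarrow> c a (\<beta> d) = \<sigma> (commutator A a (\<alpha> d))"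
    and c_\<alpha>: "d \<in> carrier D \<Longrightarrow> b \<in> carrier B \<Longrightarrow> c (\<alpha> d) b = \<tau> (commutator B (\<beta> d) b)"
    and separated: "x \<in> commutator_subgroup A \<Longrightarrow> y \<in> commutator_subgroup B \<Longrightarrow> \<sigma> x = \<tau> y \<Longrightarrow>
      d \<in> carrier D \<Longrightarrow> x = \<alpha> d \<longleftrightarrow> y = \<beta> d"
begin

lemma \<sigma>_closed [simp]: "x \<in> commutator_subgroup A \<Longrightarrow> \<sigma> x \<in> carrier E"
  using \<sigma>.hom_closed[of x] by simp

lemma \<tau>_closed [simp]: "y \<in> commutator_subgroup B \<Longrightarrow> \<tau> y \<in> carrier E"
  using \<tau>.hom_closed[of y] by simp

lemma \<sigma>_inv: "x \<in> commutator_subgroup A \<Longrightarrow> \<sigma> (inv\<^bsub>A\<^esub> x) = inv\<^bsub>E\<^esub> \<sigma> x"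
  using \<sigma>.hom_inv[of x] by (simp add: A.m_inv_consistent[OF A.subgroup_commutator_subgroup])

lemma \<tau>_inv: "y \<in> commutator_subgroup B \<Longrightarrow> \<tau> (inv\<^bsub>B\<^esub> y) = inv\<^bsub>E\<^esub> \<tau> y"
  using \<tau>.hom_inv[of y] by (simp add: B.m_inv_consistent[OF B.subgroup_commutator_subgroup])

text \<open>The commutator relators form a central subgroup, and its quotient identifies \<open>A'\<close> and \<open>B'\<close>
  with their images in \<open>E\<close>. This makes the elements \<open>\<alpha> d (\<beta> d)\<^sup>-\<^sup>1\<close> central, so that the second
  quotient, which identifies \<open>\<alpha> d\<close> with \<open>\<beta> d\<close>, is by a central subgroup as well.\<close>

definition commutator_relator :: "'a \<times> 'b \<Rightarrow> 'a \<times> 'b \<times> 'e" where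
  "commutator_relator = (\<lambda>(x, y). (x, y, inv\<^bsub>E\<^esub> \<sigma> x \<otimes>\<^bsub>E\<^esub> inv\<^bsub>E\<^esub> \<tau> y))"

definition commutator_relators :: "('a \<times> 'b \<times> 'e) set" where
  "commutator_relators = commutator_relator ` (commutator_subgroup A \<times> commutator_subgroup B)"

definition D_relator :: "'d \<Rightarrow> 'a \<times> 'b \<times> 'e" where
  "D_relator d = (\<alpha> d, inv\<^bsub>B\<^esub> \<beta> d, \<one>\<^bsub>E\<^esub>)"

lemma commutator_relators_central: "commutator_relators \<subseteq> center twisted"
proof
  fix r assume "r \<in> commutator_relators"
  then obtain x y where xy: "x \<in> commutator_subgroup A" "y \<in> commutator_subgroup B"
    "r = (x, y, inv\<^bsub>E\<^esub> \<sigma> x \<otimes>\<^bsub>E\<^esub> inv\<^bsub>E\<^esub> \<tau> y)"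
    by (auto simp: commutator_relators_def commutator_relator_def)
  have "x \<in> center A" "y \<in> center B"
    using xy A.commutator_subgroup_subset_center B.commutator_subgroup_subset_center by auto
  then show "r \<in> center twisted"
    using xy(1,2) by (auto simp: xy(3) twisted.center_iff_commutator twisted_commutator
        A.center_iff_commutator B.center_iff_commutator)
qed

lemma subgroup_commutator_relators: "subgroup commutator_relators twisted"
proof -
  let ?H = "commutator_group A \<times>\<times> commutator_group B"
  interpret H: group ?H by (rule DirProd_group) unfold_locales
  have "commutator_relator \<in> hom ?H twisted"
  proof (rule homI)
    fix h h' assume "h \<in> carrier ?H" "h' \<in> carrier ?H"
    then obtain x y x' y' where xy: "h = (x, y)" "h' = (x', y')"
      "x \<in> commutator_subgroup A" "y \<in> commutator_subgroup B"
      "x' \<in> commutator_subgroup A" "y' \<in> commutator_subgroup B" by auto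
    have "\<sigma> (x \<otimes>\<^bsub>A\<^esub> x') = \<sigma> x \<otimes>\<^bsub>E\<^esub> \<sigma> x'" "\<tau> (y \<otimes>\<^bsub>B\<^esub> y') = \<tau> y \<otimes>\<^bsub>E\<^esub> \<tau> y'"
      using xy \<sigma>.hom_mult[of x x'] \<tau>.hom_mult[of y y'] by simp_all
    then show "commutator_relator (h \<otimes>\<^bsub>?H\<^esub> h') =
        commutator_relator h \<otimes>\<^bsub>twisted\<^esub> commutator_relator h'"
      using xy by (simp add: commutator_relator_def E.inv_mult E.m_ac A.commutator_subgroup_closed)
  qed (auto simp: commutator_relator_def A.commutator_subgroup_closed B.commutator_subgroup_closed)
  then interpret h: group_hom ?H twisted commutator_relator by unfold_locales
  show ?thesis using h.img_is_subgroup by (simp add: commutator_relators_def)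
qed

definition commutator_quotient :: "('a \<times> 'b \<times> 'e) set monoid" where
  "commutator_quotient = twisted Mod commutator_relators"

sublocale coset: group_hom twisted commutator_quotient "(#>\<^bsub>twisted\<^esub>) commutator_relators"
  unfolding commutator_quotient_def
  by (intro normal.group_hom_rcoset twisted.normal_if_central subgroup_commutator_relators
      commutator_relators_central)

lemma coset_eq_one:
  "r \<in> commutator_relators \<Longrightarrow> commutator_relators #>\<^bsub>twisted\<^esub> r = \<one>\<^bsub>commutator_quotient\<^esub>"
  using twisted.coset_join2[OF _ subgroup_commutator_relators]
    subgroup.subset[OF subgroup_commutator_relators]
  by (auto simp: commutator_quotient_def)

lemma D_relator_closed [simp]: "d \<in> carrier D \<Longrightarrow> D_relator d \<in> carrier A \<times> carrier B \<times> carrier E"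
  by (simp add: D_relator_def)

lemma commutator_D_relator:
  assumes "d \<in> carrier D" "z \<in> carrier twisted"
  shows "commutator twisted (D_relator d) z \<in> commutator_relators"
proof -
  obtain a b e where z: "z = (a, b, e)" "a \<in> carrier A" "b \<in> carrier B" "e \<in> carrier E"
    using assms(2) by auto
  define x y where "x = commutator A (\<alpha> d) a" and "y = commutator B (inv\<^bsub>B\<^esub> \<beta> d) b"
  have xy: "x \<in> commutator_subgroup A" "y \<in> commutator_subgroup B"
    using assms(1) z by (simp_all add: x_def y_def A.commutator_in_commutator_subgroup
        B.commutator_in_commutator_subgroup)
  have "c a (inv\<^bsub>B\<^esub> \<beta> d) = inv\<^bsub>E\<^esub> \<sigma> (commutator A a (\<alpha> d))"
    using assms(1) z by (simp add: c.inv_right c_\<beta>)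
  also have "\<dots> = \<sigma> x"
    using assms(1) z
    by (simp add: x_def A.commutator_in_commutator_subgroup A.inv_commutator flip: \<sigma>_inv)
  finally have "inv\<^bsub>E\<^esub> c a (inv\<^bsub>B\<^esub> \<beta> d) = inv\<^bsub>E\<^esub> \<sigma> x" by simp
  moreover have "c (\<alpha> d) b = \<tau> (commutator B (\<beta> d) b)" using assms(1) z by (simp add: c_\<alpha>)
  moreover have "\<dots> = inv\<^bsub>E\<^esub> \<tau> y"
    using assms(1) z
    by (simp add: y_def B.commutator_inv_left \<tau>_inv B.commutator_in_commutator_subgroup)
  ultimately have "commutator twisted (D_relator d) z = (x, y, inv\<^bsub>E\<^esub> \<sigma> x \<otimes>\<^bsub>E\<^esub> inv\<^bsub>E\<^esub> \<tau> y)"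
    using assms(1) z xy
    by (simp add: D_relator_def twisted_commutator x_def y_def E.m_comm)
  then show ?thesis
    using xy by (auto simp: commutator_relators_def commutator_relator_def image_iff)
qed

lemma D_relator_mult:
  assumes "d \<in> carrier D" "d' \<in> carrier D"
  obtains r where "r \<in> commutator_relators"
    and "D_relator d \<otimes>\<^bsub>twisted\<^esub> D_relator d' = r \<otimes>\<^bsub>twisted\<^esub> D_relator (d \<otimes>\<^bsub>D\<^esub> d')"
proof
  define y where "y = commutator B (\<beta> d) (\<beta> d')"
  have y: "y \<in> commutator_subgroup B"
    using assms by (simp add: y_def B.commutator_in_commutator_subgroup)
  have y_closed: "y \<in> carrier B" using y by (rule B.commutator_subgroup_closed)
  have "commutator_relator (\<one>\<^bsub>A\<^esub>, y) \<in> commutator_relators"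
    unfolding commutator_relators_def
    using y subgroup.one_closed[OF A.subgroup_commutator_subgroup] by blast
  moreover have "commutator_relator (\<one>\<^bsub>A\<^esub>, y) = (\<one>\<^bsub>A\<^esub>, y, inv\<^bsub>E\<^esub> \<tau> y)"
    using \<sigma>.hom_one y by (simp add: commutator_relator_def)
  ultimately show "(\<one>\<^bsub>A\<^esub>, y, inv\<^bsub>E\<^esub> \<tau> y) \<in> commutator_relators" by simp
  have "y \<otimes>\<^bsub>B\<^esub> inv\<^bsub>B\<^esub> (\<beta> d \<otimes>\<^bsub>B\<^esub> \<beta> d') = inv\<^bsub>B\<^esub> \<beta> d \<otimes>\<^bsub>B\<^esub> inv\<^bsub>B\<^esub> \<beta> d'"
    using assms y_closed
    by (subst B.inv_solve_right') (simp_all add: y_def commutator_def B.m_assoc)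
  moreover have "c (\<alpha> d') (inv\<^bsub>B\<^esub> \<beta> d) = inv\<^bsub>E\<^esub> \<tau> (commutator B (\<beta> d') (\<beta> d))"
    using assms by (simp add: c.inv_right c_\<alpha>)
  moreover have "\<dots> = \<tau> y"
    using assms
    by (simp add: y_def B.commutator_in_commutator_subgroup B.inv_commutator flip: \<tau>_inv)
  ultimately show "D_relator d \<otimes>\<^bsub>twisted\<^esub> D_relator d' =
      (\<one>\<^bsub>A\<^esub>, y, inv\<^bsub>E\<^esub> \<tau> y) \<otimes>\<^bsub>twisted\<^esub> D_relator (d \<otimes>\<^bsub>D\<^esub> d')"
    using assms y y_closed by (simp add: D_relator_def)
qed

abbreviation D_coset :: "'d \<Rightarrow> ('a \<times> 'b \<times> 'e) set" where
  "D_coset d \<equiv> commutator_relators #>\<^bsub>twisted\<^esub> D_relator d"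

sublocale D_coset: group_hom D commutator_quotient D_coset
proof
  show "D_coset \<in> hom D commutator_quotient"
  proof (rule homI)
    fix d d' assume d: "d \<in> carrier D" "d' \<in> carrier D"
    then obtain r where r: "r \<in> commutator_relators"
      "D_relator d \<otimes>\<^bsub>twisted\<^esub> D_relator d' = r \<otimes>\<^bsub>twisted\<^esub> D_relator (d \<otimes>\<^bsub>D\<^esub> d')"
      by (rule D_relator_mult)
    have "D_coset d \<otimes>\<^bsub>commutator_quotient\<^esub> D_coset d' =
        commutator_relators #>\<^bsub>twisted\<^esub> (r \<otimes>\<^bsub>twisted\<^esub> D_relator (d \<otimes>\<^bsub>D\<^esub> d'))"
      using d by (simp flip: coset.hom_mult r(2))
    also have "\<dots> = D_coset (d \<otimes>\<^bsub>D\<^esub> d')"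
      using d twisted.rcoset_mult_left[OF subgroup_commutator_relators r(1)] by simp
    finally show "D_coset (d \<otimes>\<^bsub>D\<^esub> d') = D_coset d \<otimes>\<^bsub>commutator_quotient\<^esub> D_coset d'" ..
  qed simp
qed

lemma D_cosets_central: "D_coset ` carrier D \<subseteq> center commutator_quotient"
proof clarify
  fix d assume d: "d \<in> carrier D"
  have "commutator commutator_quotient (D_coset d) \<zeta> = \<one>\<^bsub>commutator_quotient\<^esub>"
    if \<zeta>: "\<zeta> \<in> carrier commutator_quotient" for \<zeta>
  proof -
    obtain z where z: "\<zeta> = commutator_relators #>\<^bsub>twisted\<^esub> z" "z \<in> carrier twisted"
      using \<zeta> unfolding commutator_quotient_def carrier_FactGroup by blast
    then show ?thesis
      using d by (simp add: coset_eq_one commutator_D_relator flip: coset.hom_commutator)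
  qed
  then show "D_coset d \<in> center commutator_quotient"
    using d by (simp add: coset.H.center_iff_commutator)
qed

definition amalgam_quotient :: "('a \<times> 'b \<times> 'e) set set monoid" where
  "amalgam_quotient = commutator_quotient Mod (D_coset ` carrier D)"

definition quotient_map :: "'a \<times> 'b \<times> 'e \<Rightarrow> ('a \<times> 'b \<times> 'e) set set" where
  "quotient_map z = D_coset ` carrier D #>\<^bsub>commutator_quotient\<^esub> (commutator_relators #>\<^bsub>twisted\<^esub> z)"

lemma normal_D_cosets: "D_coset ` carrier D \<lhd> commutator_quotient"
  by (rule coset.H.normal_if_central[OF D_coset.img_is_subgroup D_cosets_central])

sublocale quotient: group_hom twisted amalgam_quotient quotient_map
proof -
  interpret projection: group_hom commutator_quotient amalgam_quotient
    "(#>\<^bsub>commutator_quotient\<^esub>) (D_coset ` carrier D)"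
    unfolding amalgam_quotient_def by (rule normal.group_hom_rcoset[OF normal_D_cosets])
  have "quotient_map \<in> hom twisted amalgam_quotient"
    using hom_compose[OF coset.homh projection.homh]
    by (simp add: quotient_map_def[abs_def] comp_def)
  then show "group_hom twisted amalgam_quotient quotient_map" by unfold_locales
qed

lemma in_variety_amalgam_quotient: "in_variety m n amalgam_quotient"
proof (rule in_variety_surj_hom[OF in_variety_twisted quotient.group_hom_axioms])
  show "quotient_map ` carrier twisted = carrier amalgam_quotient"
    by (simp add: quotient_map_def[abs_def] amalgam_quotient_def commutator_quotient_def
        carrier_FactGroup image_image)
qed

lemma quotient_map_eq_one:
  assumes a: "a \<in> carrier A" and b: "b \<in> carrier B"
    and one: "quotient_map (a, b, \<one>\<^bsub>E\<^esub>) = \<one>\<^bsub>amalgam_quotient\<^esub>"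
  shows "a = \<one>\<^bsub>A\<^esub> \<longleftrightarrow> b = \<one>\<^bsub>B\<^esub>"
proof -
  have "commutator_relators #>\<^bsub>twisted\<^esub> (a, b, \<one>\<^bsub>E\<^esub>) \<in> D_coset ` carrier D"
    using one a b coset.H.coset_join1[OF _ _ D_coset.img_is_subgroup]
      subgroup.subset[OF D_coset.img_is_subgroup]
    by (simp add: quotient_map_def amalgam_quotient_def)
  then obtain d where d: "d \<in> carrier D"
    and eq: "commutator_relators #>\<^bsub>twisted\<^esub> (a, b, \<one>\<^bsub>E\<^esub>) = D_coset d"
    by blast
  obtain r where "r \<in> commutator_relators" "(a, b, \<one>\<^bsub>E\<^esub>) = r \<otimes>\<^bsub>twisted\<^esub> D_relator d"
    by (rule twisted.rcoset_eqE[OF subgroup_commutator_relators _ _ eq]) (use a b d in auto)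
  then obtain x y where xy: "x \<in> commutator_subgroup A" "y \<in> commutator_subgroup B"
    and "(a, b, \<one>\<^bsub>E\<^esub>) = (x, y, inv\<^bsub>E\<^esub> \<sigma> x \<otimes>\<^bsub>E\<^esub> inv\<^bsub>E\<^esub> \<tau> y) \<otimes>\<^bsub>twisted\<^esub> (\<alpha> d, inv\<^bsub>B\<^esub> \<beta> d, \<one>\<^bsub>E\<^esub>)"
    by (auto simp: commutator_relators_def commutator_relator_def D_relator_def)
  moreover note closed = A.commutator_subgroup_closed[OF xy(1)] \<sigma>_closed[OF xy(1)]
    B.commutator_subgroup_closed[OF xy(2)] \<tau>_closed[OF xy(2)]
  moreover have "c (\<alpha> d) y = \<one>\<^bsub>E\<^esub>" using d xy(2) by simp
  ultimately have eqs: "a = x \<otimes>\<^bsub>A\<^esub> \<alpha> d" "b = y \<otimes>\<^bsub>B\<^esub> inv\<^bsub>B\<^esub> \<beta> d" "\<one>\<^bsub>E\<^esub> = inv\<^bsub>E\<^esub> \<sigma> x \<otimes>\<^bsub>E\<^esub> inv\<^bsub>E\<^esub> \<tau> y"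
    by simp_all
  have "inv\<^bsub>E\<^esub> \<tau> y \<otimes>\<^bsub>E\<^esub> inv\<^bsub>E\<^esub> \<sigma> x = \<one>\<^bsub>E\<^esub>" using eqs(3) closed by (simp add: E.m_comm)
  from E.inv_equality[OF this] have "\<sigma> x = \<tau> (inv\<^bsub>B\<^esub> y)" using closed xy by (simp add: \<tau>_inv)
  from separated[OF xy(1) _ this, of "inv\<^bsub>D\<^esub> d"]
  have "x = inv\<^bsub>A\<^esub> \<alpha> d \<longleftrightarrow> inv\<^bsub>B\<^esub> y = inv\<^bsub>B\<^esub> \<beta> d"
    using d xy subgroup.m_inv_closed[OF B.subgroup_commutator_subgroup] by simp
  moreover have "a = \<one>\<^bsub>A\<^esub> \<longleftrightarrow> x = inv\<^bsub>A\<^esub> \<alpha> d"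
    using d closed A.inv_equality[of x "\<alpha> d"] by (auto simp: eqs(1))
  moreover have "b = \<one>\<^bsub>B\<^esub> \<longleftrightarrow> inv\<^bsub>B\<^esub> y = inv\<^bsub>B\<^esub> \<beta> d"
    using d closed B.inv_equality[of y "inv\<^bsub>B\<^esub> \<beta> d"] B.inv_inj by (auto simp: eqs(2))
  ultimately show ?thesis by simp
qed

lemma weak_embedding_quotient:
  "weak_embedding m n A B D \<alpha> \<beta> amalgam_quotient
     (\<lambda>a. quotient_map (a, \<one>\<^bsub>B\<^esub>, \<one>\<^bsub>E\<^esub>)) (\<lambda>b. quotient_map (\<one>\<^bsub>A\<^esub>, b, \<one>\<^bsub>E\<^esub>))"
  (is "weak_embedding m n A B D \<alpha> \<beta> _ ?\<phi> ?\<psi>")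
proof -
  have "?\<phi> \<in> hom A amalgam_quotient"
    by (rule homI) (simp_all flip: quotient.hom_mult)
  then interpret \<phi>: group_hom A amalgam_quotient ?\<phi> by unfold_locales
  have "?\<psi> \<in> hom B amalgam_quotient"
    by (rule homI) (simp_all flip: quotient.hom_mult)
  then interpret \<psi>: group_hom B amalgam_quotient ?\<psi> by unfold_locales
  have "inj_on ?\<phi> (carrier A)"
    using quotient_map_eq_one[of _ "\<one>\<^bsub>B\<^esub>"] by (intro \<phi>.inj_on_one_iff[THEN iffD2]) auto
  moreover have "inj_on ?\<psi> (carrier B)"
    using quotient_map_eq_one[of "\<one>\<^bsub>A\<^esub>"] by (intro \<psi>.inj_on_one_iff[THEN iffD2]) auto
  moreover have "?\<phi> (\<alpha> d) = ?\<psi> (\<beta> d)" if d: "d \<in> carrier D" for d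
  proof -
    have "?\<phi> (\<alpha> d) = quotient_map (D_relator d \<otimes>\<^bsub>twisted\<^esub> (\<one>\<^bsub>A\<^esub>, \<beta> d, \<one>\<^bsub>E\<^esub>))"
      using d by (simp add: D_relator_def)
    also have "\<dots> = quotient_map (D_relator d) \<otimes>\<^bsub>amalgam_quotient\<^esub> ?\<psi> (\<beta> d)"
      using d by (intro quotient.hom_mult) simp_all
    also have "quotient_map (D_relator d) = \<one>\<^bsub>amalgam_quotient\<^esub>"
      unfolding quotient_map_def amalgam_quotient_def one_FactGroup
      using d by (intro coset.H.coset_join2 D_coset.img_is_subgroup) simp_all
    finally show ?thesis using d by simp
  qed
  ultimately show ?thesis
    unfolding weak_embedding_def
    using in_variety_amalgam_quotient \<phi>.homh \<psi>.homh by blast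
qed

end

section \<open>Pushouts of commutative groups\<close>

definition list_prod :: "('a, 'r) monoid_scheme \<Rightarrow> 'a list \<Rightarrow> 'a" where
  "list_prod G xs = foldr (\<otimes>\<^bsub>G\<^esub>) xs \<one>\<^bsub>G\<^esub>"

lemma list_prod_simps [simp]:
  "list_prod G [] = \<one>\<^bsub>G\<^esub>" "list_prod G (x # xs) = x \<otimes>\<^bsub>G\<^esub> list_prod G xs"
  by (simp_all add: list_prod_def)

lemma list_prod_subgroup: "list_prod (G\<lparr>carrier := H\<rparr>) xs = list_prod G xs"
  by (simp add: list_prod_def)

lemma ordered_prod_eq_list_prod: "ordered_prod G f k = list_prod G (map f [1..<Suc k])"
  by (simp add: ordered_prod_def list_prod_def)

lemma (in monoid) list_prod_closed: "xs \<in> lists (carrier G) \<Longrightarrow> list_prod G xs \<in> carrier G"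
  by (induction xs) auto

lemma (in monoid) list_prod_append:
  "xs \<in> lists (carrier G) \<Longrightarrow> ys \<in> lists (carrier G) \<Longrightarrow>
    list_prod G (xs @ ys) = list_prod G xs \<otimes> list_prod G ys"
  by (induction xs) (auto simp: list_prod_closed m_assoc)

lemma (in group_hom) hom_list_prod:
  "xs \<in> lists (carrier G) \<Longrightarrow> h (list_prod G xs) = list_prod H (map h xs)"
  by (induction xs) (auto simp: G.list_prod_closed)

lemma (in group) generate_imp_list_prod:
  assumes "T \<subseteq> carrier G" "\<And>t. t \<in> T \<Longrightarrow> inv t \<in> T" and "x \<in> generate G T"
  shows "\<exists>xs\<in>lists T. x = list_prod G xs"
  using assms(3)
proof (induction x rule: generate.induct)
  case one
  show ?case by (rule bexI[of _ "[]"]) simp_all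
next
  case (incl t)
  then show ?case using assms(1) by (intro bexI[of _ "[t]"]) auto
next
  case (inv t)
  then show ?case using assms(1,2) by (intro bexI[of _ "[inv t]"]) auto
next
  case (eng x y)
  then obtain xs ys where xs: "xs \<in> lists T" "x = list_prod G xs"
    and ys: "ys \<in> lists T" "y = list_prod G ys" by blast
  moreover have "xs \<in> lists (carrier G)" "ys \<in> lists (carrier G)"
    using xs(1) ys(1) lists_mono[OF assms(1)] by blast+
  ultimately show ?case by (intro bexI[of _ "xs @ ys"]) (simp_all add: list_prod_append)
qed

locale pushout =
  S: comm_group S + T: comm_group T
  for S :: "('a, 'r) monoid_scheme" and T :: "('b, 's) monoid_scheme" +
  fixes I :: "'i set" and f :: "'i \<Rightarrow> 'a" and g :: "'i \<Rightarrow> 'b"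
  assumes f_closed [simp]: "i \<in> I \<Longrightarrow> f i \<in> carrier S"
    and g_closed [simp]: "i \<in> I \<Longrightarrow> g i \<in> carrier T"
    and inv_index: "i \<in> I \<Longrightarrow> \<exists>j\<in>I. f j = inv\<^bsub>S\<^esub> f i \<and> g j = inv\<^bsub>T\<^esub> g i"
begin

definition relation :: "'i \<Rightarrow> 'a \<times> 'b" where
  "relation i = (f i, inv\<^bsub>T\<^esub> g i)"

definition relations :: "('a \<times> 'b) set" where
  "relations = generate (S \<times>\<times> T) (relation ` I)"

definition quotient :: "('a \<times> 'b) set monoid" where
  "quotient = (S \<times>\<times> T) Mod relations"

definition left :: "'a \<Rightarrow> ('a \<times> 'b) set" where
  "left s = relations #>\<^bsub>S \<times>\<times> T\<^esub> (s, \<one>\<^bsub>T\<^esub>)"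

definition right :: "'b \<Rightarrow> ('a \<times> 'b) set" where
  "right t = relations #>\<^bsub>S \<times>\<times> T\<^esub> (\<one>\<^bsub>S\<^esub>, t)"

sublocale prod: comm_group "S \<times>\<times> T"
  by (intro comm_group_DirProd S.comm_group_axioms T.comm_group_axioms)

lemma relation_closed: "relation ` I \<subseteq> carrier (S \<times>\<times> T)"
  by (auto simp: relation_def)

lemma subgroup_relations: "subgroup relations (S \<times>\<times> T)"
  unfolding relations_def by (rule prod.generate_is_subgroup[OF relation_closed])

sublocale quotient: comm_group quotient
  unfolding quotient_def by (rule prod.abelian_FactGroup[OF subgroup_relations])

lemma normal_relations: "relations \<lhd> S \<times>\<times> T"
  by (rule prod.subgroup_imp_normal[OF subgroup_relations])

sublocale coset: group_hom "S \<times>\<times> T" quotient "(#>\<^bsub>S \<times>\<times> T\<^esub>) relations"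
  unfolding quotient_def by (rule normal.group_hom_rcoset[OF normal_relations])

sublocale left: group_hom S quotient left
proof
  show "left \<in> hom S quotient"
    by (rule homI) (simp_all add: left_def flip: coset.hom_mult)
qed

sublocale right: group_hom T quotient right
proof
  show "right \<in> hom T quotient"
    by (rule homI) (simp_all add: right_def flip: coset.hom_mult)
qed

lemma left_f_eq_right_g:
  assumes i: "i \<in> I"
  shows "left (f i) = right (g i)"
proof -
  have "relation i \<in> relations" unfolding relations_def using i by (blast intro: generate.incl)
  then show ?thesis
    using i prod.rcoset_mult_left[OF subgroup_relations, of "relation i" "(\<one>\<^bsub>S\<^esub>, g i)"]
    by (simp add: left_def right_def relation_def)
qed

lemma relations_imp_list_prod:
  assumes "r \<in> relations"
  obtains js where "js \<in> lists I" "r = list_prod (S \<times>\<times> T) (map relation js)"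
proof -
  have "inv\<^bsub>S \<times>\<times> T\<^esub> t \<in> relation ` I" if t: "t \<in> relation ` I" for t
  proof -
    obtain i where i: "i \<in> I" "t = relation i" using t by blast
    then obtain j where j: "j \<in> I" "f j = inv\<^bsub>S\<^esub> f i" "g j = inv\<^bsub>T\<^esub> g i" using inv_index by blast
    then have "inv\<^bsub>S \<times>\<times> T\<^esub> t = relation j"
      using i by (simp add: relation_def inv_DirProd S.group_axioms T.group_axioms)
    with j(1) show ?thesis by blast
  qed
  then obtain ts where "ts \<in> lists (relation ` I)" "r = list_prod (S \<times>\<times> T) ts"
    using prod.generate_imp_list_prod[OF relation_closed] assms unfolding relations_def by blast
  then show thesis using that by (auto simp: lists_image)
qed

lemma left_eq_right_imp_list_prod:
  assumes s: "s \<in> carrier S" and t: "t \<in> carrier T" and eq: "left s = right t"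
  obtains js where "js \<in> lists I" "s = list_prod S (map f js)" "t = list_prod T (map g js)"
proof -
  obtain r where "r \<in> relations" and r: "(s, \<one>\<^bsub>T\<^esub>) = r \<otimes>\<^bsub>S \<times>\<times> T\<^esub> (\<one>\<^bsub>S\<^esub>, t)"
    by (rule prod.rcoset_eqE[OF subgroup_relations _ _ eq[unfolded left_def right_def]])
      (use s t in auto)
  obtain x y where xy: "r = (x, y)" "x \<in> carrier S" "y \<in> carrier T"
    using subgroup.subset[OF subgroup_relations] \<open>r \<in> relations\<close> by (cases r) auto
  then have "r = (s, inv\<^bsub>T\<^esub> t)" using r s t T.inv_equality[of y t] by simp
  obtain js where js: "js \<in> lists I" "r = list_prod (S \<times>\<times> T) (map relation js)"
    using \<open>r \<in> relations\<close> by (rule relations_imp_list_prod)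
  have closed: "map relation js \<in> lists (carrier (S \<times>\<times> T))"
    using js(1) relation_closed by (auto simp: lists_eq_set)
  have "fst \<in> hom (S \<times>\<times> T) S" by (auto simp: hom_def)
  then interpret fst: group_hom "S \<times>\<times> T" S fst by unfold_locales
  have "(\<lambda>z. inv\<^bsub>T\<^esub> snd z) \<in> hom (S \<times>\<times> T) T" by (auto simp: hom_def T.inv_mult)
  then interpret snd: group_hom "S \<times>\<times> T" T "\<lambda>z. inv\<^bsub>T\<^esub> snd z" by unfold_locales
  have map_g: "map ((\<lambda>z. inv\<^bsub>T\<^esub> snd z) \<circ> relation) js = map g js"
    using js(1) by (auto simp: relation_def)
  then have "t = list_prod T (map g js)"
    using snd.hom_list_prod[OF closed] \<open>r = (s, inv\<^bsub>T\<^esub> t)\<close> t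
    by (simp only: map_map map_g snd_conv T.inv_inv flip: js(2))
  moreover have "s = list_prod S (map f js)"
    using fst.hom_list_prod[OF closed] \<open>r = (s, inv\<^bsub>T\<^esub> t)\<close>
    by (simp add: comp_def relation_def flip: js(2))
  ultimately show thesis using js(1) that by blast
qed

lemma quotient_exponent:
  assumes "\<And>s. s \<in> carrier S \<Longrightarrow> s [^]\<^bsub>S\<^esub> (n :: nat) = \<one>\<^bsub>S\<^esub>" "\<And>t. t \<in> carrier T \<Longrightarrow> t [^]\<^bsub>T\<^esub> n = \<one>\<^bsub>T\<^esub>"
    and "z \<in> carrier quotient"
  shows "z [^]\<^bsub>quotient\<^esub> n = \<one>\<^bsub>quotient\<^esub>"
  unfolding quotient_def
proof (rule normal.FactGroup_exponent[OF normal_relations])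
  show "st [^]\<^bsub>S \<times>\<times> T\<^esub> n = \<one>\<^bsub>S \<times>\<times> T\<^esub>" if "st \<in> carrier (S \<times>\<times> T)" for st
    using that assms(1,2) by (cases st) (simp add: nat_pow_DirProd)
qed (use assms(3) in \<open>simp add: quotient_def\<close>)

end

section \<open>Amalgams\<close>

lemma all_fun_prod_iff:
  fixes R :: "('i \<Rightarrow> 'a \<times> 'b) \<Rightarrow> bool"
  shows "(\<forall>x. R x) \<longleftrightarrow> (\<forall>f g. R (\<lambda>i. (f i, g i)))"
proof (intro iffI allI)
  fix x assume "\<forall>f g. R (\<lambda>i. (f i, g i))"
  from this[rule_format, of "\<lambda>i. fst (x i)" "\<lambda>i. snd (x i)"] show "R x" by simp
qed blast

lemma ball_nonempty_lists_iff_sequences: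
  "(\<forall>xs\<in>lists S. xs \<noteq> [] \<longrightarrow> R xs) \<longleftrightarrow>
     (\<forall>k>0. \<forall>x. (\<forall>i\<in>{1..k}. x i \<in> S) \<longrightarrow> R (map x [1..<Suc k]))"
proof (intro iffI allI ballI impI)
  fix k :: nat and x
  assume R: "\<forall>xs\<in>lists S. xs \<noteq> [] \<longrightarrow> R xs" and x: "\<forall>i\<in>{1..k}. x i \<in> S" and "k > 0"
  then have "map x [1..<Suc k] \<in> lists S" "map x [1..<Suc k] \<noteq> []" by auto
  with R show "R (map x [1..<Suc k])" by blast
next
  fix xs assume R: "\<forall>k>0. \<forall>x. (\<forall>i\<in>{1..k}. x i \<in> S) \<longrightarrow> R (map x [1..<Suc k])"
    and xs: "xs \<in> lists S" "xs \<noteq> []"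
  define x where "x i = xs ! (i - 1)" for i
  have "x i \<in> S" if "i \<in> {1..length xs}" for i
    using xs(1) that by (auto simp: x_def)
  then have "R (map x [1..<Suc (length xs)])" using R xs(2) by blast
  moreover have "map x [1..<Suc (length xs)] = xs"
    by (rule nth_equalityI) (simp_all add: x_def del: upt_Suc)
  ultimately show "R xs" by simp
qed

locale variety_amalgam =
  A: variety_group A m n + B: variety_group B m n + \<alpha>: group_hom D A \<alpha> + \<beta>: group_hom D B \<beta>
  for A :: "('a, 'r) monoid_scheme" and B :: "('b, 's) monoid_scheme"
    and D :: "('d, 't) monoid_scheme" and \<alpha> \<beta> m n +
  assumes inj_\<alpha>: "inj_on \<alpha> (carrier D)" and inj_\<beta>: "inj_on \<beta> (carrier D)"
begin

lemma swap: "variety_amalgam B A D \<beta> \<alpha> m n"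
  by (intro variety_amalgam.intro variety_amalgam_axioms.intro
      A.variety_group_axioms B.variety_group_axioms \<alpha>.group_hom_axioms \<beta>.group_hom_axioms inj_\<alpha> inj_\<beta>)

definition matched :: "(nat \<times> 'a \<times> 'a \<times> 'b \<times> 'b \<times> 'd \<times> 'd) set" where
  "matched = {(q, a, a', b, b', u, v). q > 0 \<and> q dvd n \<and>
     a \<in> carrier A \<and> a' \<in> verbal_subgroup n A \<and> u \<in> carrier D \<and> a [^]\<^bsub>A\<^esub> q \<otimes>\<^bsub>A\<^esub> a' = \<alpha> u \<and>
     b \<in> carrier B \<and> b' \<in> verbal_subgroup n B \<and> v \<in> carrier D \<and> b [^]\<^bsub>B\<^esub> q \<otimes>\<^bsub>B\<^esub> b' = \<beta> v}"

definition A_commutator :: "nat \<times> 'a \<times> 'a \<times> 'b \<times> 'b \<times> 'd \<times> 'd \<Rightarrow> 'a" where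
  "A_commutator = (\<lambda>(q, a, a', b, b', u, v). commutator A a (\<alpha> v))"

definition B_commutator :: "nat \<times> 'a \<times> 'a \<times> 'b \<times> 'b \<times> 'd \<times> 'd \<Rightarrow> 'b" where
  "B_commutator = (\<lambda>(q, a, a', b, b', u, v). commutator B (\<beta> u) b)"

definition product_condition :: bool where
  "product_condition \<longleftrightarrow> (\<forall>L\<in>lists matched. \<forall>d\<in>carrier D.
     list_prod A (map A_commutator L) = \<alpha> d \<longleftrightarrow> list_prod B (map B_commutator L) = \<beta> d)"

lemma A_commutator_in: "t \<in> matched \<Longrightarrow> A_commutator t \<in> commutator_subgroup A"
  by (auto simp: matched_def A_commutator_def intro!: A.commutator_in_commutator_subgroup)

lemma B_commutator_in: "t \<in> matched \<Longrightarrow> B_commutator t \<in> commutator_subgroup B"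
  by (auto simp: matched_def B_commutator_def intro!: B.commutator_in_commutator_subgroup)

lemma matched_if_cosets_eq:
  assumes q: "q > 0" "q dvd n" and a: "a \<in> carrier A" and b: "b \<in> carrier B"
    and u: "u \<in> carrier D" "A.verbal_coset (\<alpha> u) = A.verbal_coset (a [^]\<^bsub>A\<^esub> q)"
    and v: "v \<in> carrier D" "B.verbal_coset (\<beta> v) = B.verbal_coset (b [^]\<^bsub>B\<^esub> q)"
  obtains a' b' where "(q, a, a', b, b', u, v) \<in> matched"
proof -
  obtain a' where a': "a' \<in> verbal_subgroup n A" "\<alpha> u = a' \<otimes>\<^bsub>A\<^esub> a [^]\<^bsub>A\<^esub> q"
    by (rule A.rcoset_eqE[OF A.subgroup_verbal_subgroup _ _ u(2)]) (use a u(1) in auto)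
  obtain b' where b': "b' \<in> verbal_subgroup n B" "\<beta> v = b' \<otimes>\<^bsub>B\<^esub> b [^]\<^bsub>B\<^esub> q"
    by (rule B.rcoset_eqE[OF B.subgroup_verbal_subgroup _ _ v(2)]) (use b v(1) in auto)
  have "a' \<in> center A" "b' \<in> center B"
    using a'(1) b'(1) A.verbal_subgroup_subset_center B.verbal_subgroup_subset_center by auto
  then have "a [^]\<^bsub>A\<^esub> q \<otimes>\<^bsub>A\<^esub> a' = \<alpha> u" "b [^]\<^bsub>B\<^esub> q \<otimes>\<^bsub>B\<^esub> b' = \<beta> v"
    using a a'(2) A.center_commutes[of a' "a [^]\<^bsub>A\<^esub> q"]
      b b'(2) B.center_commutes[of b' "b [^]\<^bsub>B\<^esub> q"] by simp_all
  then show thesis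
    using assms a'(1) b'(1) by (intro that[of a' b']) (simp add: matched_def)
qed

lemma matched_inv:
  assumes matched: "(q, a, a', b, b', u, v) \<in> matched"
  shows "(q, inv\<^bsub>A\<^esub> a, inv\<^bsub>A\<^esub> a', b, b', inv\<^bsub>D\<^esub> u, v) \<in> matched"
proof -
  have a: "a \<in> carrier A" and u: "u \<in> carrier D" and a': "a' \<in> verbal_subgroup n A"
    using matched by (auto simp: matched_def)
  have a'_center: "a' \<in> center A" using a' A.verbal_subgroup_subset_center by auto
  have "\<alpha> u = a' \<otimes>\<^bsub>A\<^esub> a [^]\<^bsub>A\<^esub> q"
    using matched a A.center_commutes[OF a'_center, of "a [^]\<^bsub>A\<^esub> q"] by (simp add: matched_def)
  then have "(inv\<^bsub>A\<^esub> a) [^]\<^bsub>A\<^esub> q \<otimes>\<^bsub>A\<^esub> inv\<^bsub>A\<^esub> a' = \<alpha> (inv\<^bsub>D\<^esub> u)"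
    using a u A.center_closed[OF a'_center] by (simp add: A.inv_mult_group A.nat_pow_inv)
  moreover have "inv\<^bsub>A\<^esub> a' \<in> verbal_subgroup n A"
    using subgroup.m_inv_closed[OF A.subgroup_verbal_subgroup a'] .
  ultimately show ?thesis using matched by (simp add: matched_def)
qed

lemma product_condition_iff_nonempty:
  "product_condition \<longleftrightarrow> (\<forall>L\<in>lists matched. L \<noteq> [] \<longrightarrow> (\<forall>d\<in>carrier D.
     list_prod A (map A_commutator L) = \<alpha> d \<longleftrightarrow> list_prod B (map B_commutator L) = \<beta> d))"
proof -
  have "\<one>\<^bsub>A\<^esub> = \<alpha> d \<longleftrightarrow> \<one>\<^bsub>B\<^esub> = \<beta> d" if "d \<in> carrier D" for d
    using that inj_onD[OF inj_\<alpha>, of d "\<one>\<^bsub>D\<^esub>"] inj_onD[OF inj_\<beta>, of d "\<one>\<^bsub>D\<^esub>"] by auto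
  then have "\<forall>d\<in>carrier D. list_prod A (map A_commutator L) = \<alpha> d \<longleftrightarrow>
      list_prod B (map B_commutator L) = \<beta> d" if "L = []" for L
    using that by simp
  then show ?thesis unfolding product_condition_def by blast
qed

lemma product_condition_iff:
  "product_condition \<longleftrightarrow>
    (\<forall>k q a a' b b' u v. k > 0 \<longrightarrow>
       (\<forall>i\<in>{1..k}. (q i, a i, a' i, b i, b' i, u i, v i) \<in> matched) \<longrightarrow>
       (\<forall>d\<in>carrier D.
          ordered_prod A (\<lambda>i. commutator A (a i) (\<alpha> (v i))) k = \<alpha> d \<longleftrightarrow>
          ordered_prod B (\<lambda>i. commutator B (\<beta> (u i)) (b i)) k = \<beta> d))"
proof -
  have "product_condition \<longleftrightarrow> (\<forall>k>0. \<forall>x. (\<forall>i\<in>{1..k}. x i \<in> matched) \<longrightarrow> (\<forall>d\<in>carrier D.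
      list_prod A (map A_commutator (map x [1..<Suc k])) = \<alpha> d \<longleftrightarrow>
      list_prod B (map B_commutator (map x [1..<Suc k])) = \<beta> d))"
    unfolding product_condition_iff_nonempty by (rule ball_nonempty_lists_iff_sequences)
  also have "\<dots> \<longleftrightarrow> (\<forall>k>0. \<forall>x. (\<forall>i\<in>{1..k}. x i \<in> matched) \<longrightarrow> (\<forall>d\<in>carrier D.
      ordered_prod A (\<lambda>i. A_commutator (x i)) k = \<alpha> d \<longleftrightarrow>
      ordered_prod B (\<lambda>i. B_commutator (x i)) k = \<beta> d))"
    by (simp only: ordered_prod_eq_list_prod map_map comp_def)
  finally show ?thesis
    by (simp add: all_fun_prod_iff A_commutator_def B_commutator_def)
qed

lemma center_if_weak_embedding:
  assumes emb: "weak_embedding m n A B D \<alpha> \<beta> M \<phi> \<psi>"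
    and d: "d \<in> carrier D" "\<alpha> d \<in> verbal_subgroup n A"
  shows "\<beta> d \<in> center B"
proof -
  have M: "in_variety m n M" and \<phi>: "\<phi> \<in> hom A M" and \<psi>: "\<psi> \<in> hom B M" "inj_on \<psi> (carrier B)"
    and agree: "\<phi> (\<alpha> d) = \<psi> (\<beta> d)"
    using emb d(1) by (auto simp: weak_embedding_def)
  interpret M: variety_group M m n by (rule variety_groupI[OF M])
  interpret \<phi>: group_hom A M \<phi> by unfold_locales (rule \<phi>)
  interpret \<psi>: group_hom B M \<psi> by unfold_locales (rule \<psi>)
  have "\<psi> (\<beta> d) \<in> center M"
    using \<phi>.hom_verbal_subgroup[OF d(2)] M.verbal_subgroup_subset_center agree by auto
  then have "\<psi> (\<beta> d \<otimes>\<^bsub>B\<^esub> b) = \<psi> (b \<otimes>\<^bsub>B\<^esub> \<beta> d)" if "b \<in> carrier B" for b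
    using d(1) that by (simp add: M.center_commutes)
  then have "\<beta> d \<otimes>\<^bsub>B\<^esub> b = b \<otimes>\<^bsub>B\<^esub> \<beta> d" if "b \<in> carrier B" for b
    using d(1) that by (intro inj_onD[OF \<psi>(2)]) auto
  then show ?thesis using d(1) by (intro B.centerI) auto
qed

lemma commutators_agree_if_weak_embedding:
  assumes emb: "weak_embedding m n A B D \<alpha> \<beta> M \<phi> \<psi>" and "t \<in> matched"
  shows "\<phi> (A_commutator t) = \<psi> (B_commutator t)"
proof -
  have M: "in_variety m n M" and \<phi>: "\<phi> \<in> hom A M" and \<psi>: "\<psi> \<in> hom B M"
    and agree: "\<And>d. d \<in> carrier D \<Longrightarrow> \<phi> (\<alpha> d) = \<psi> (\<beta> d)"
    using emb by (auto simp: weak_embedding_def)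
  interpret M: variety_group M m n by (rule variety_groupI[OF M])
  interpret \<phi>: group_hom A M \<phi> by unfold_locales (rule \<phi>)
  interpret \<psi>: group_hom B M \<psi> by unfold_locales (rule \<psi>)
  obtain q a a' b b' u v where t: "t = (q, a, a', b, b', u, v)" by (cases t)
  have closed: "a \<in> carrier A" "b \<in> carrier B" "u \<in> carrier D" "v \<in> carrier D"
    and a': "a' \<in> verbal_subgroup n A" and b': "b' \<in> verbal_subgroup n B"
    and powers: "a [^]\<^bsub>A\<^esub> q \<otimes>\<^bsub>A\<^esub> a' = \<alpha> u" "b [^]\<^bsub>B\<^esub> q \<otimes>\<^bsub>B\<^esub> b' = \<beta> v"
    using \<open>t \<in> matched\<close> by (simp_all add: t matched_def)
  have a'_closed: "a' \<in> carrier A" and b'_closed: "b' \<in> carrier B"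
    using a' b' subgroup.mem_carrier[OF A.subgroup_verbal_subgroup]
      subgroup.mem_carrier[OF B.subgroup_verbal_subgroup] by auto
  have central: "\<phi> a' \<in> center M" "\<psi> b' \<in> center M"
    using \<phi>.hom_verbal_subgroup[OF a'] \<psi>.hom_verbal_subgroup[OF b']
      M.verbal_subgroup_subset_center by auto
  have "\<phi> (commutator A a (\<alpha> v)) = commutator M (\<phi> a) (\<psi> (\<beta> v))"
    using closed by (simp add: \<phi>.hom_commutator agree)
  also have "\<dots> = commutator M (\<phi> a) (\<psi> b [^]\<^bsub>M\<^esub> q \<otimes>\<^bsub>M\<^esub> \<psi> b')"
    using closed b'_closed by (simp flip: powers \<psi>.hom_nat_pow \<psi>.hom_mult)
  also have "\<dots> = commutator M (\<phi> a [^]\<^bsub>M\<^esub> q \<otimes>\<^bsub>M\<^esub> \<phi> a') (\<psi> b)"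
    using closed central by (intro M.commutator_pow_mult_center[symmetric]) auto
  also have "\<dots> = commutator M (\<phi> (\<alpha> u)) (\<psi> b)"
    using closed a'_closed by (simp flip: powers \<phi>.hom_nat_pow \<phi>.hom_mult)
  also have "\<dots> = \<psi> (commutator B (\<beta> u) b)"
    using closed by (simp add: \<psi>.hom_commutator agree)
  finally show ?thesis by (simp add: t A_commutator_def B_commutator_def)
qed

lemma product_condition_if_weak_embedding:
  assumes emb: "weak_embedding m n A B D \<alpha> \<beta> M \<phi> \<psi>"
  shows product_condition
  unfolding product_condition_def
proof (intro ballI)
  fix L d assume L: "L \<in> lists matched" and d: "d \<in> carrier D"
  have \<phi>: "\<phi> \<in> hom A M" "inj_on \<phi> (carrier A)" and \<psi>: "\<psi> \<in> hom B M" "inj_on \<psi> (carrier B)"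
    and agree: "\<phi> (\<alpha> d) = \<psi> (\<beta> d)" and "group M"
    using emb d by (auto simp: weak_embedding_def in_variety_def)
  interpret M: group M by fact
  interpret \<phi>: group_hom A M \<phi> by unfold_locales (rule \<phi>)
  interpret \<psi>: group_hom B M \<psi> by unfold_locales (rule \<psi>)
  have A: "map A_commutator L \<in> lists (carrier A)"
    using L A_commutator_in subgroup.mem_carrier[OF A.subgroup_commutator_subgroup] by auto
  have B: "map B_commutator L \<in> lists (carrier B)"
    using L B_commutator_in subgroup.mem_carrier[OF B.subgroup_commutator_subgroup] by auto
  have "map \<phi> (map A_commutator L) = map \<psi> (map B_commutator L)"
    using L commutators_agree_if_weak_embedding[OF emb] by auto
  then have eq: "\<phi> (list_prod A (map A_commutator L)) = \<psi> (list_prod B (map B_commutator L))"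
    by (simp only: \<phi>.hom_list_prod[OF A] \<psi>.hom_list_prod[OF B])
  have "list_prod A (map A_commutator L) = \<alpha> d \<longleftrightarrow> \<phi> (list_prod A (map A_commutator L)) = \<phi> (\<alpha> d)"
    using inj_on_eq_iff[OF \<phi>(2)] A.list_prod_closed[OF A] d by simp
  also have "\<dots> \<longleftrightarrow> \<psi> (list_prod B (map B_commutator L)) = \<psi> (\<beta> d)" by (simp only: eq agree)
  also have "\<dots> \<longleftrightarrow> list_prod B (map B_commutator L) = \<beta> d"
    using inj_on_eq_iff[OF \<psi>(2)] B.list_prod_closed[OF B] d by simp
  finally show "list_prod A (map A_commutator L) = \<alpha> d \<longleftrightarrow> list_prod B (map B_commutator L) = \<beta> d" .
qed

sublocale pushout: pushout "commutator_group A" "commutator_group B"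
  matched A_commutator B_commutator
proof (intro pushout.intro pushout_axioms.intro
    A.comm_group_commutator_subgroup B.comm_group_commutator_subgroup)
  fix t assume t: "t \<in> matched"
  obtain q a a' b b' u v where t_eq: "t = (q, a, a', b, b', u, v)" by (cases t)
  have closed: "a \<in> carrier A" "b \<in> carrier B" "u \<in> carrier D" "v \<in> carrier D"
    using t by (auto simp: t_eq matched_def)
  let ?t' = "(q, inv\<^bsub>A\<^esub> a, inv\<^bsub>A\<^esub> a', b, b', inv\<^bsub>D\<^esub> u, v)"
  have "A_commutator ?t' = inv\<^bsub>commutator_group A\<^esub> A_commutator t"
    using closed A_commutator_in[OF t] A.m_inv_consistent[OF A.subgroup_commutator_subgroup]
    by (simp add: t_eq A_commutator_def A.commutator_inv_left)
  moreover have "B_commutator ?t' = inv\<^bsub>commutator_group B\<^esub> B_commutator t"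
    using closed B_commutator_in[OF t] B.m_inv_consistent[OF B.subgroup_commutator_subgroup]
    by (simp add: t_eq B_commutator_def B.commutator_inv_left)
  ultimately show "\<exists>t'\<in>matched. A_commutator t' = inv\<^bsub>commutator_group A\<^esub> A_commutator t \<and>
      B_commutator t' = inv\<^bsub>commutator_group B\<^esub> B_commutator t"
    using matched_inv t t_eq by blast
qed (simp_all add: A_commutator_in B_commutator_in)

lemma pushout_exponent:
  "z \<in> carrier pushout.quotient \<Longrightarrow> z [^]\<^bsub>pushout.quotient\<^esub> n = \<one>\<^bsub>pushout.quotient\<^esub>"
  by (rule pushout.quotient_exponent)
    (simp_all add: A.commutator_subgroup_pow_n B.commutator_subgroup_pow_n
      flip: A.nat_pow_consistent B.nat_pow_consistent)

lemma pushout_separated: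
  assumes product_condition and x: "x \<in> commutator_subgroup A" and y: "y \<in> commutator_subgroup B"
    and eq: "pushout.left x = pushout.right y" and d: "d \<in> carrier D"
  shows "x = \<alpha> d \<longleftrightarrow> y = \<beta> d"
proof -
  obtain L where "L \<in> lists matched"
    "x = list_prod A (map A_commutator L)" "y = list_prod B (map B_commutator L)"
    using pushout.left_eq_right_imp_list_prod[OF _ _ eq] x y by (auto simp: list_prod_subgroup)
  then show ?thesis using assms(1) d by (simp add: product_condition_def)
qed

abbreviation D_in_A :: "'a set set" where
  "D_in_A \<equiv> (\<lambda>d. A.verbal_coset (\<alpha> d)) ` carrier D"

abbreviation D_in_B :: "'b set set" where
  "D_in_B \<equiv> (\<lambda>d. B.verbal_coset (\<beta> d)) ` carrier D"

lemma group_hom_D_in_B: "group_hom D B.verbal_quotient (\<lambda>d. B.verbal_coset (\<beta> d))"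
  using hom_compose[OF \<beta>.homh B.verbal_coset.homh]
  by (simp add: group_hom_def group_hom_axioms_def comp_def \<alpha>.G.group_axioms
      B.verbal_coset.H.group_axioms)

lemma A_commutator_map:
  assumes central: "\<And>d. d \<in> carrier D \<Longrightarrow> \<beta> d \<in> verbal_subgroup n B \<Longrightarrow> \<alpha> d \<in> center A"
    and C: "comm_group C" and \<chi>: "\<chi> \<in> hom (commutator_group A) C"
  obtains f
  where "bilinear_map A.verbal_quotient B.verbal_quotient C (carrier A.verbal_quotient) D_in_B f"
    and "\<And>a d. a \<in> carrier A \<Longrightarrow> d \<in> carrier D \<Longrightarrow>
      f (A.verbal_coset a) (B.verbal_coset (\<beta> d)) = \<chi> (commutator A a (\<alpha> d))"
proof -
  have "group (commutator_group A)" "group C"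
    using A.comm_group_commutator_subgroup C by (simp_all add: comm_group_def)
  then have \<chi>_one: "\<chi> \<one>\<^bsub>A\<^esub> = \<one>\<^bsub>C\<^esub>" using hom_one[OF \<chi>] by simp
  have "group_hom A A (\<lambda>a. a)" by unfold_locales (simp add: hom_def)
  then have "bilinear_map A D C (carrier A) (carrier D) (\<lambda>a d. \<chi> (commutator A a (\<alpha> d)))"
    by (rule A.commutator.compose[OF _ _ \<alpha>.group_hom_axioms _ C \<chi>]) auto
  moreover have "\<chi> (commutator A a (\<alpha> d)) = \<one>\<^bsub>C\<^esub>"
    if "a \<in> carrier A" "A.verbal_coset a = \<one>\<^bsub>A.verbal_quotient\<^esub>" "d \<in> carrier D" for a d
  proof -
    have "a \<in> center A"
      using that A.verbal_coset_eq_one_iff A.verbal_subgroup_subset_center by blast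
    then show ?thesis using that(3) \<chi>_one by (simp add: A.center_iff_commutator)
  qed
  moreover have "\<chi> (commutator A a (\<alpha> d)) = \<one>\<^bsub>C\<^esub>"
    if "a \<in> carrier A" "d \<in> carrier D" "B.verbal_coset (\<beta> d) = \<one>\<^bsub>B.verbal_quotient\<^esub>" for a d
  proof -
    have "\<beta> d \<in> verbal_subgroup n B" using that B.verbal_coset_eq_one_iff \<beta>.hom_closed by blast
    then show ?thesis using that central \<chi>_one by (simp add: A.commutator_center_right)
  qed
  ultimately show thesis
  proof (rule bilinear_map_factor[OF _ A.verbal_coset.group_hom_axioms group_hom_D_in_B])
    fix f
    assume "bilinear_map A.verbal_quotient B.verbal_quotient C (A.verbal_coset ` carrier A) D_in_B f"
      and "\<And>a d. a \<in> carrier A \<Longrightarrow> d \<in> carrier D \<Longrightarrow>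
        f (A.verbal_coset a) (B.verbal_coset (\<beta> d)) = \<chi> (commutator A a (\<alpha> d))"
    then show thesis using that by (simp add: carrier_FactGroup)
  qed
qed

lemma B_commutator_map:
  assumes central: "\<And>d. d \<in> carrier D \<Longrightarrow> \<alpha> d \<in> verbal_subgroup n A \<Longrightarrow> \<beta> d \<in> center B"
    and C: "comm_group C" and \<chi>: "\<chi> \<in> hom (commutator_group B) C"
  obtains g
  where "bilinear_map A.verbal_quotient B.verbal_quotient C D_in_A (carrier B.verbal_quotient) g"
    and "\<And>b d. b \<in> carrier B \<Longrightarrow> d \<in> carrier D \<Longrightarrow>
      g (A.verbal_coset (\<alpha> d)) (B.verbal_coset b) = \<chi> (commutator B (\<beta> d) b)"
proof -
  interpret C: comm_group C by (rule C)
  interpret \<chi>: group_hom "commutator_group B" C \<chi>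
    using \<chi> B.comm_group_commutator_subgroup C.group_axioms
    by (simp add: group_hom_def group_hom_axioms_def comm_group_def)
  obtain h
    where h: "bilinear_map B.verbal_quotient A.verbal_quotient C (carrier B.verbal_quotient) D_in_A h"
    and h_eq: "\<And>b d. b \<in> carrier B \<Longrightarrow> d \<in> carrier D \<Longrightarrow>
      h (B.verbal_coset b) (A.verbal_coset (\<alpha> d)) = inv\<^bsub>C\<^esub> \<chi> (commutator B b (\<beta> d))"
    using variety_amalgam.A_commutator_map[OF swap central C C.hom_inv[OF \<chi>]] by blast
  have "h (B.verbal_coset b) (A.verbal_coset (\<alpha> d)) = \<chi> (commutator B (\<beta> d) b)"
    if "b \<in> carrier B" "d \<in> carrier D" for b d
    using that \<chi>.hom_inv[of "commutator B b (\<beta> d)"]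
    by (simp add: h_eq B.commutator_in_commutator_subgroup B.inv_commutator
        B.m_inv_consistent[OF B.subgroup_commutator_subgroup])
  with bilinear_map.swap[OF h] show thesis by (rule that)
qed

lemma commutator_maps_compatible:
  assumes f: "\<And>a d. a \<in> carrier A \<Longrightarrow> d \<in> carrier D \<Longrightarrow>
      f (A.verbal_coset a) (B.verbal_coset (\<beta> d)) = pushout.left (commutator A a (\<alpha> d))"
    and g: "\<And>b d. b \<in> carrier B \<Longrightarrow> d \<in> carrier D \<Longrightarrow>
      g (A.verbal_coset (\<alpha> d)) (B.verbal_coset b) = pushout.right (commutator B (\<beta> d) b)"
    and q: "q > 0" "q dvd n"
    and "\<xi> \<in> carrier A.verbal_quotient" "\<eta> \<in> carrier B.verbal_quotient"
    and powers: "\<xi> [^]\<^bsub>A.verbal_quotient\<^esub> q \<in> D_in_A" "\<eta> [^]\<^bsub>B.verbal_quotient\<^esub> q \<in> D_in_B"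
  shows "f \<xi> (\<eta> [^]\<^bsub>B.verbal_quotient\<^esub> q) = g (\<xi> [^]\<^bsub>A.verbal_quotient\<^esub> q) \<eta>"
proof -
  obtain a b where a: "a \<in> carrier A" "\<xi> = A.verbal_coset a"
    and b: "b \<in> carrier B" "\<eta> = B.verbal_coset b"
    using assms(5,6) by (auto simp: carrier_FactGroup)
  obtain u v where u: "u \<in> carrier D" "\<xi> [^]\<^bsub>A.verbal_quotient\<^esub> q = A.verbal_coset (\<alpha> u)"
    and v: "v \<in> carrier D" "\<eta> [^]\<^bsub>B.verbal_quotient\<^esub> q = B.verbal_coset (\<beta> v)"
    using powers by blast
  have "A.verbal_coset (\<alpha> u) = A.verbal_coset (a [^]\<^bsub>A\<^esub> q)"
    "B.verbal_coset (\<beta> v) = B.verbal_coset (b [^]\<^bsub>B\<^esub> q)"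
    using a b u(2) v(2) by (simp_all add: A.verbal_coset.hom_nat_pow B.verbal_coset.hom_nat_pow)
  from matched_if_cosets_eq[OF q a(1) b(1) u(1) this(1) v(1) this(2)]
  obtain a' b' where "(q, a, a', b, b', u, v) \<in> matched" .
  from pushout.left_f_eq_right_g[OF this]
  have "pushout.left (commutator A a (\<alpha> v)) = pushout.right (commutator B (\<beta> u) b)"
    by (simp add: A_commutator_def B_commutator_def)
  then show ?thesis
    unfolding u(2) v(2) using a b u(1) v(1) by (simp add: f g)
qed

lemma partial_commutator_maps:
  assumes central_B: "\<And>d. d \<in> carrier D \<Longrightarrow> \<alpha> d \<in> verbal_subgroup n A \<Longrightarrow> \<beta> d \<in> center B"
    and central_A: "\<And>d. d \<in> carrier D \<Longrightarrow> \<beta> d \<in> verbal_subgroup n B \<Longrightarrow> \<alpha> d \<in> center A"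
  obtains f g
  where "partial_bilinear_maps A.verbal_quotient B.verbal_quotient pushout.quotient
      D_in_A D_in_B f g n"
    and "\<And>a d. a \<in> carrier A \<Longrightarrow> d \<in> carrier D \<Longrightarrow>
      f (A.verbal_coset a) (B.verbal_coset (\<beta> d)) = pushout.left (commutator A a (\<alpha> d))"
    and "\<And>b d. b \<in> carrier B \<Longrightarrow> d \<in> carrier D \<Longrightarrow>
      g (A.verbal_coset (\<alpha> d)) (B.verbal_coset b) = pushout.right (commutator B (\<beta> d) b)"
proof -
  note C = pushout.quotient.comm_group_axioms
  obtain f where f: "bilinear_map A.verbal_quotient B.verbal_quotient pushout.quotient
      (carrier A.verbal_quotient) D_in_B f"
    and f_eq: "\<And>a d. a \<in> carrier A \<Longrightarrow> d \<in> carrier D \<Longrightarrow>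
      f (A.verbal_coset a) (B.verbal_coset (\<beta> d)) = pushout.left (commutator A a (\<alpha> d))"
    using A_commutator_map[OF central_A C pushout.left.homh] by blast
  obtain g where g: "bilinear_map A.verbal_quotient B.verbal_quotient pushout.quotient
      D_in_A (carrier B.verbal_quotient) g"
    and g_eq: "\<And>b d. b \<in> carrier B \<Longrightarrow> d \<in> carrier D \<Longrightarrow>
      g (A.verbal_coset (\<alpha> d)) (B.verbal_coset b) = pushout.right (commutator B (\<beta> d) b)"
    using B_commutator_map[OF central_B C pushout.right.homh] by blast
  have "partial_bilinear_maps A.verbal_quotient B.verbal_quotient pushout.quotient
      D_in_A D_in_B f g n"
    by (intro partial_bilinear_maps.intro partial_bilinear_maps_axioms.intro f g
        A.comm_group_verbal_quotient B.comm_group_verbal_quotient C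
        group_hom.img_is_subgroup[OF group_hom_D_in_B]
        group_hom.img_is_subgroup[OF variety_amalgam.group_hom_D_in_B[OF swap]]
        A.verbal_quotient_exponent B.verbal_quotient_exponent
        commutator_maps_compatible[OF f_eq g_eq])
  then show thesis using f_eq g_eq by (rule that)
qed

lemma extended_commutator_map:
  assumes central_B: "\<And>d. d \<in> carrier D \<Longrightarrow> \<alpha> d \<in> verbal_subgroup n A \<Longrightarrow> \<beta> d \<in> center B"
    and central_A: "\<And>d. d \<in> carrier D \<Longrightarrow> \<beta> d \<in> verbal_subgroup n B \<Longrightarrow> \<alpha> d \<in> center A"
  obtains E :: "(('b set \<Rightarrow> 'a set) \<times> ('a \<times> 'b) set) set monoid" and c \<iota>
  where "bilinear_map A B E (carrier A) (carrier B) c"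
    and "\<And>e. e \<in> carrier E \<Longrightarrow> e [^]\<^bsub>E\<^esub> n = \<one>\<^bsub>E\<^esub>"
    and "\<iota> \<in> hom pushout.quotient E" "inj_on \<iota> (carrier pushout.quotient)"
    and "\<And>a d. a \<in> carrier A \<Longrightarrow> d \<in> carrier D \<Longrightarrow> c a (\<beta> d) = \<iota> (pushout.left (commutator A a (\<alpha> d)))"
    and "\<And>b d. b \<in> carrier B \<Longrightarrow> d \<in> carrier D \<Longrightarrow> c (\<alpha> d) b = \<iota> (pushout.right (commutator B (\<beta> d) b))"
proof -
  obtain f g where partial: "partial_bilinear_maps A.verbal_quotient B.verbal_quotient
      pushout.quotient D_in_A D_in_B f g n"
    and f_eq: "\<And>a d. a \<in> carrier A \<Longrightarrow> d \<in> carrier D \<Longrightarrow>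
      f (A.verbal_coset a) (B.verbal_coset (\<beta> d)) = pushout.left (commutator A a (\<alpha> d))"
    and g_eq: "\<And>b d. b \<in> carrier B \<Longrightarrow> d \<in> carrier D \<Longrightarrow>
      g (A.verbal_coset (\<alpha> d)) (B.verbal_coset b) = pushout.right (commutator B (\<beta> d) b)"
    using partial_commutator_maps[OF central_B central_A] by blast
  interpret partial: partial_bilinear_maps A.verbal_quotient B.verbal_quotient
    pushout.quotient D_in_A D_in_B f g n
    by (rule partial)
  show thesis
  proof
    show "bilinear_map A B partial.extension (carrier A) (carrier B)
        (\<lambda>a b. partial.extended_map (A.verbal_coset a) (B.verbal_coset b))"
      by (rule bilinear_map.compose[OF partial.bilinear_map_extended_map
            A.verbal_coset.group_hom_axioms _ B.verbal_coset.group_hom_axioms _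
            partial.extension.comm_group_axioms iso_imp_homomorphism[OF iso_set_refl]])
        auto
    show "e [^]\<^bsub>partial.extension\<^esub> n = \<one>\<^bsub>partial.extension\<^esub>"
      if "e \<in> carrier partial.extension" for e
      using pushout_exponent that by (rule partial.extension_exponent)
  qed (simp_all add: partial.inclusion_hom partial.inclusion_inj partial.extended_map_f
      partial.extended_map_g f_eq g_eq)
qed

lemma weakly_embeddable_if:
  assumes dvd: "n dvd m div gcd 2 m"
    and central_B: "\<And>d. d \<in> carrier D \<Longrightarrow> \<alpha> d \<in> verbal_subgroup n A \<Longrightarrow> \<beta> d \<in> center B"
    and central_A: "\<And>d. d \<in> carrier D \<Longrightarrow> \<beta> d \<in> verbal_subgroup n B \<Longrightarrow> \<alpha> d \<in> center A"
    and product_condition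
  shows "weakly_embeddable m n A B D \<alpha> \<beta>"
proof -
  obtain E :: "(('b set \<Rightarrow> 'a set) \<times> ('a \<times> 'b) set) set monoid" and c \<iota>
    where c: "bilinear_map A B E (carrier A) (carrier B) c"
      and exponent: "\<And>e. e \<in> carrier E \<Longrightarrow> e [^]\<^bsub>E\<^esub> n = \<one>\<^bsub>E\<^esub>"
      and \<iota>: "\<iota> \<in> hom pushout.quotient E" "inj_on \<iota> (carrier pushout.quotient)"
      and c_\<beta>: "\<And>a d. a \<in> carrier A \<Longrightarrow> d \<in> carrier D \<Longrightarrow>
        c a (\<beta> d) = \<iota> (pushout.left (commutator A a (\<alpha> d)))"
      and c_\<alpha>: "\<And>b d. b \<in> carrier B \<Longrightarrow> d \<in> carrier D \<Longrightarrow>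
        c (\<alpha> d) b = \<iota> (pushout.right (commutator B (\<beta> d) b))"
    using extended_commutator_map[OF central_B central_A] by blast
  interpret c: bilinear_map A B E "carrier A" "carrier B" c by (rule c)
  interpret \<sigma>: group_hom "commutator_group A" E "\<iota> \<circ> pushout.left"
    by unfold_locales (rule hom_compose[OF pushout.left.homh \<iota>(1)])
  interpret \<tau>: group_hom "commutator_group B" E "\<iota> \<circ> pushout.right"
    by unfold_locales (rule hom_compose[OF pushout.right.homh \<iota>(1)])
  interpret twisted_amalgam A B E m n c D \<alpha> \<beta> "\<iota> \<circ> pushout.left" "\<iota> \<circ> pushout.right"
  proof
    fix x y d assume xy: "x \<in> commutator_subgroup A" "y \<in> commutator_subgroup B"
      and eq: "(\<iota> \<circ> pushout.left) x = (\<iota> \<circ> pushout.right) y" and d: "d \<in> carrier D"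
    have "pushout.left x = pushout.right y" using eq xy by (intro inj_onD[OF \<iota>(2)]) auto
    from pushout_separated[OF \<open>product_condition\<close> xy this d] show "x = \<alpha> d \<longleftrightarrow> y = \<beta> d" .
  qed (simp_all add: dvd exponent c_\<beta> c_\<alpha>)
  show ?thesis
    by (rule weakly_embeddableI[OF A.group_axioms B.group_axioms weak_embedding_quotient])
qed

lemma weakly_embeddable_iff:
  assumes "n dvd m div gcd 2 m"
  shows "weakly_embeddable m n A B D \<alpha> \<beta> \<longleftrightarrow>
    ((\<forall>d\<in>carrier D. \<alpha> d \<in> verbal_subgroup n A \<longrightarrow> \<beta> d \<in> center B) \<and>
     (\<forall>d\<in>carrier D. \<beta> d \<in> verbal_subgroup n B \<longrightarrow> \<alpha> d \<in> center A)) \<and> product_condition"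
  (is "_ \<longleftrightarrow> (?central_B \<and> ?central_A) \<and> _")
proof
  assume "weakly_embeddable m n A B D \<alpha> \<beta>"
  then obtain M :: "('a + 'b) list monoid" and \<phi> \<psi> where emb: "weak_embedding m n A B D \<alpha> \<beta> M \<phi> \<psi>"
    by (auto simp: weakly_embeddable_def)
  then have emb': "weak_embedding m n B A D \<beta> \<alpha> M \<psi> \<phi>" by (auto simp: weak_embedding_def)
  show "(?central_B \<and> ?central_A) \<and> product_condition"
    using center_if_weak_embedding[OF emb] variety_amalgam.center_if_weak_embedding[OF swap emb']
      product_condition_if_weak_embedding[OF emb] by blast
next
  assume "(?central_B \<and> ?central_A) \<and> product_condition"
  then show "weakly_embeddable m n A B D \<alpha> \<beta>"
    using weakly_embeddable_if[OF assms] by blast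
qed

end

lemma variety_amalgamI:
  assumes "amalgam m n A B D \<alpha> \<beta>"
  shows "variety_amalgam A B D \<alpha> \<beta> m n"
  using assms
  by (simp add: amalgam_def variety_amalgam_def variety_amalgam_axioms_def variety_groupI
      group_hom_def group_hom_axioms_def in_variety_def)

theorem theorem2p4:
  fixes m n :: nat
    and A :: "('a, 'r) monoid_scheme"
    and B :: "('b, 's) monoid_scheme"
    and D :: "('d, 't) monoid_scheme"
    and \<alpha> :: "'d \<Rightarrow> 'a" and \<beta> :: "'d \<Rightarrow> 'b"
  assumes "n dvd m div gcd 2 m"
    and "amalgam m n A B D \<alpha> \<beta>"
  shows "weakly_embeddable m n A B D \<alpha> \<beta> \<longleftrightarrow>
    ((\<forall>d \<in> carrier D. \<alpha> d \<in> power_subgroup A n <#>\<^bsub>A\<^esub> commutator_subgroup A \<longrightarrow> \<beta> d \<in> center B) \<and>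
     (\<forall>d \<in> carrier D. \<beta> d \<in> power_subgroup B n <#>\<^bsub>B\<^esub> commutator_subgroup B \<longrightarrow> \<alpha> d \<in> center A)) \<and>
    (\<forall>(k :: nat) (q :: nat \<Rightarrow> nat) (a :: nat \<Rightarrow> 'a) (a' :: nat \<Rightarrow> 'a) (b :: nat \<Rightarrow> 'b) (b' :: nat \<Rightarrow> 'b)
        (u :: nat \<Rightarrow> 'd) (v :: nat \<Rightarrow> 'd).
       k > 0 \<longrightarrow>
       (\<forall>i \<in> {1..k}.
          q i > 0 \<and> q i dvd n \<and>
          a i \<in> carrier A \<and> a' i \<in> power_subgroup A n <#>\<^bsub>A\<^esub> commutator_subgroup A \<and>
          u i \<in> carrier D \<and> a i [^]\<^bsub>A\<^esub> q i \<otimes>\<^bsub>A\<^esub> a' i = \<alpha> (u i) \<and>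
          b i \<in> carrier B \<and> b' i \<in> power_subgroup B n <#>\<^bsub>B\<^esub> commutator_subgroup B \<and>
          v i \<in> carrier D \<and> b i [^]\<^bsub>B\<^esub> q i \<otimes>\<^bsub>B\<^esub> b' i = \<beta> (v i)) \<longrightarrow>
       (\<forall>d \<in> carrier D.
          ordered_prod A (\<lambda>i. commutator A (a i) (\<alpha> (v i))) k = \<alpha> d \<longleftrightarrow>
          ordered_prod B (\<lambda>i. commutator B (\<beta> (u i)) (b i)) k = \<beta> d))"
proof -
  interpret variety_amalgam A B D \<alpha> \<beta> m n by (rule variety_amalgamI[OF assms(2)])
  show ?thesis
    using weakly_embeddable_iff[OF assms(1)]
    unfolding product_condition_iff matched_def verbal_subgroup_def mem_Collect_eq case_prod_conv .
qed

end
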